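(* Let $\mathbb{G}$ be a graph embedded in an orientable surface, and let $R(\mathbb{G};x,y)$ be its ribbon graph polynomial. Then $R(\mathbb{G};x,y)$ is irreducible over $\mathbb{Z}[x,y]$ if and only if $\mathbb{G}$ is connected and is not a join of two smaller embedded graphs. The same equivalence holds with $\mathbb{Z}[x,y]$ replaced by $\mathbb{C}[x,y]$.
   Context: Embedded graphs are finite graphs drawn on closed surfaces so that edges do not meet except at common vertices and faces are homeomorphic to discs (that is, the embedding is cellular); a disconnected embedded graph lives on a disjoint union of surfaces, one for each connected component. Embedded graphs are equivalent to ribbon graphs. A ribbon graph $\mathbb{G}=(V,E)$ is a surface with boundary represented as the union of two sets of discs, a set $V$ of vertices and a set $E$ of edges, such that: (1) the vertices and edges intersect in disjoint line segments; (2) each such line segment lies on the boundary of precisely one vertex and precisely one edge; (3) every edge contains exactly two such line segments. The ribbon graph is obtained from an embedded graph by taking a regular neighbourhood of the graph in the surface; $\mathbb{G}$ is orientable if it is orientable as a surface with boundary (equivalently, the graph is embedded in an orientable surface). A vertex is isolated if it meets no edge. For $A\subseteq E$, $r(A)$ is the number of vertices minus the number of connected components of the spanning ribbon subgraph $(V,A)$, and $\gamma(A)$ is the Euler genus of $(V,A)$: twice its genus if it is orientable, and its genus if it is non-orientable. (Equivalently $\gamma(A)=2k(A)-|V|+|A|-f(A)$, where $k(A)$ and $f(A)$ are the numbers of connected components and of boundary components of $(V,A)$.) Put $\sigma(A)=r(A)+\tfrac12\gamma(A)$. The ribbon graph polynomial is $$R(\mathbb{G};x,y)=\sum_{A\subseteq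 E}(x-1)^{\sigma(E)-\sigma(A)}(y-1)^{|A|-\sigma(A)}.$$ Join: an embedded graph is a join if it can be obtained from two embedded graphs $\mathbb{G}_1,\mathbb{G}_2$ by choosing a disc in each surface whose boundary intersects the graph in that surface at exactly a single non-isolated vertex, identifying the two discs so that the vertices on their boundaries are also identified, and deleting the interior of the identified discs. In ribbon graph terms: pick an arc on the boundary of a non-isolated vertex in each of $\mathbb{G}_1$ and $\mathbb{G}_2$ (the arcs not intersecting any edges), identify the two arcs, and merge the two vertices on which they lie into a single vertex. Convention: a polynomial is called irreducible over a ring if it has no non-trivial factorization, i.e. it is not a product of two non-unit polynomials over that ring; in particular the constant polynomial $1$ (the polynomial of a graph with a single vertex and no edges) counts as irreducible.
   Formalization: The embedded graph is assumed to have no isolated vertices unless it is a single vertex; otherwise the claim fails: a plane loop plus an isolated vertex is disconnected, yet R = y is irreducible. *)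

theory Defs
  imports Complex_Main "HOL-Combinatorics.Orbits" "HOL-Computational_Algebra.Polynomial"
begin

text \<open>
  A graph embedded in an orientable surface (equivalently, an orientable ribbon graph) is given
  by its rotation system, for a chosen orientation of the surface.  The darts are the half-edges:
  each edge of the ribbon graph consists of a dart and its opposite, one for each of the two line
  segments in which the edge meets vertices.  For a dart d lying on the vertex \<open>vert G d\<close>, \<open>rot G d\<close>
  is the next dart in the cyclic order around the boundary of that vertex.  The darts of one
  vertex form a single cycle, and vertices without darts are isolated.
\<close>

record ('v, 'd) ribbon_graph =
  verts :: "'v set"
  darts :: "'d set"
  vert :: "'d \<Rightarrow> 'v"
  rot :: "'d \<Rightarrow> 'd"
  opp :: "'d \<Rightarrow> 'd"

definition orientable_ribbon_graph :: "('v, 'd) ribbon_graph \<Rightarrow> bool" where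
  "orientable_ribbon_graph G \<longleftrightarrow>
     finite (verts G) \<and> finite (darts G) \<and>
     (\<forall>d\<in>darts G. vert G d \<in> verts G) \<and>
     rot G permutes darts G \<and>
     (\<forall>d\<in>darts G. orbit (rot G) d = {e \<in> darts G. vert G e = vert G d}) \<and>
     opp G permutes darts G \<and>
     (\<forall>d\<in>darts G. opp G d \<noteq> d \<and> opp G (opp G d) = d)"

definition edges :: "('v, 'd) ribbon_graph \<Rightarrow> 'd set set" where
  "edges G = {{d, opp G d} | d. d \<in> darts G}"

definition isolated_verts :: "('v, 'd) ribbon_graph \<Rightarrow> 'v set" where
  "isolated_verts G = verts G - vert G ` darts G"


text \<open>
  Below, \<open>A \<subseteq> edges G\<close> stands for the spanning ribbon subgraph \<open>(V, A)\<close>, whose darts are \<open>\<Union>A\<close>.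
\<close>

definition adjacency :: "('v, 'd) ribbon_graph \<Rightarrow> 'd set set \<Rightarrow> ('v \<times> 'v) set" where
  "adjacency G A = {(vert G d, vert G (opp G d)) | d. d \<in> \<Union>A}"

definition same_component :: "('v, 'd) ribbon_graph \<Rightarrow> 'd set set \<Rightarrow> ('v \<times> 'v) set" where
  "same_component G A = {(u, v) \<in> verts G \<times> verts G. (u, v) \<in> (adjacency G A)\<^sup>*}"

definition num_components :: "('v, 'd) ribbon_graph \<Rightarrow> 'd set set \<Rightarrow> nat" where
  "num_components G A = card (verts G // same_component G A)"

definition connected_graph :: "('v, 'd) ribbon_graph \<Rightarrow> bool" where
  "connected_graph G \<longleftrightarrow> (\<forall>u\<in>verts G. \<forall>v\<in>verts G. (u, v) \<in> same_component G (edges G))"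

text \<open>
  The darts cut the boundary of each non-isolated vertex of \<open>G\<close> into arcs; identify each arc with
  the dart at which it ends.  Travelling along a boundary component of \<open>(V, A)\<close>, one reaches
  the end d of the current arc.  If d belongs to \<open>A\<close>, the boundary follows the side of that edge
  and continues with the arc right after the opposite dart; otherwise the edge is absent and
  the boundary continues with the arc right after d itself.  So the boundary components are
  the orbits of \<open>boundary_step\<close>, together with one for each isolated vertex of \<open>G\<close>.
\<close>

definition boundary_step :: "('v, 'd) ribbon_graph \<Rightarrow> 'd set set \<Rightarrow> 'd \<Rightarrow> 'd" where
  "boundary_step G A d = rot G (if d \<in> \<Union>A then opp G d else d)"

definition num_boundary :: "('v, 'd) ribbon_graph \<Rightarrow> 'd set set \<Rightarrow> nat" where
  "num_boundary G A =
     card ((\<lambda>d. orbit (boundary_step G A) d) ` darts G) + card (isolated_verts G)"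

definition rk :: "('v, 'd) ribbon_graph \<Rightarrow> 'd set set \<Rightarrow> int" where
  "rk G A = int (card (verts G)) - int (num_components G A)"

definition euler_genus :: "('v, 'd) ribbon_graph \<Rightarrow> 'd set set \<Rightarrow> int" where
  "euler_genus G A =
     2 * int (num_components G A) - int (card (verts G)) + int (card A) - int (num_boundary G A)"

text \<open>
  For an orientable ribbon graph the Euler genus of \<open>(V, A)\<close> is even (twice the genus), so the
  integer division is exact.  Both exponents in \<open>ribbon_poly\<close> are nonnegative.
\<close>

definition sigma :: "('v, 'd) ribbon_graph \<Rightarrow> 'd set set \<Rightarrow> int" where
  "sigma G A = rk G A + euler_genus G A div 2"

text \<open>The ring \<open>'a[x, y]\<close> is rendered as \<open>'a[x][y]\<close>.\<close>

definition var_x :: "'a :: comm_ring_1 poly poly" where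
  "var_x = [:[:0, 1:]:]"

definition var_y :: "'a :: comm_ring_1 poly poly" where
  "var_y = [:0, 1:]"

definition ribbon_poly :: "('v, 'd) ribbon_graph \<Rightarrow> 'a :: comm_ring_1 poly poly" where
  "ribbon_poly G =
     (\<Sum>A \<in> Pow (edges G).
        (var_x - 1) ^ nat (sigma G (edges G) - sigma G A) *
        (var_y - 1) ^ nat (int (card A) - sigma G A))"

text \<open>
  Unlike the library's \<open>irreducible\<close>, the following convention counts units as irreducible.
\<close>

definition no_nontrivial_factorization :: "'a :: comm_semiring_1 \<Rightarrow> bool" where
  "no_nontrivial_factorization p \<longleftrightarrow> (\<forall>a b. p = a * b \<longrightarrow> a dvd 1 \<or> b dvd 1)"


text \<open>
  The join of \<open>G1\<close> and \<open>G2\<close> along the arc that starts at the dart d1 of \<open>G1\<close> and the arc that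
  starts at the dart d2 of \<open>G2\<close>.  The two vertices to be merged have been given the same name
  beforehand, and \<open>G1\<close> and \<open>G2\<close> are otherwise disjoint.  Around the merged vertex, d1 is followed
  by the darts of \<open>G2\<close> from the successor of d2 up to d2, and then by the darts of \<open>G1\<close> from the
  successor of d1 up to d1.
\<close>

definition joinable ::
  "('v, 'd) ribbon_graph \<Rightarrow> 'd \<Rightarrow> ('v, 'd) ribbon_graph \<Rightarrow> 'd \<Rightarrow> bool" where
  "joinable G1 d1 G2 d2 \<longleftrightarrow>
     d1 \<in> darts G1 \<and> d2 \<in> darts G2 \<and> darts G1 \<inter> darts G2 = {} \<and>
     vert G1 d1 = vert G2 d2 \<and> verts G1 \<inter> verts G2 = {vert G1 d1}"

definition join ::
  "('v, 'd) ribbon_graph \<Rightarrow> 'd \<Rightarrow> ('v, 'd) ribbon_graph \<Rightarrow> 'd \<Rightarrow> ('v, 'd) ribbon_graph" where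
  "join G1 d1 G2 d2 =
     \<lparr> verts = verts G1 \<union> verts G2,
       darts = darts G1 \<union> darts G2,
       vert = (\<lambda>d. if d \<in> darts G1 then vert G1 d else vert G2 d),
       rot = (rot G1 \<circ> rot G2)(d1 := rot G2 d2, d2 := rot G1 d1),
       opp = opp G1 \<circ> opp G2 \<rparr>"

text \<open>
  Isomorphisms need not be mentioned here: if \<open>G\<close> is isomorphic to a join, transporting the two
  parts along the isomorphism presents \<open>G\<close> itself as a join, and the value of \<open>vert\<close> outside
  the darts can be chosen freely in \<open>G2\<close>.  The parts of a join that is orientable are orientable,
  with orientations that match along the arc.
\<close>

definition is_join_of_smaller :: "('v, 'd) ribbon_graph \<Rightarrow> bool" where
  "is_join_of_smaller G \<longleftrightarrow>
     (\<exists>G1 d1 G2 d2.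
        orientable_ribbon_graph G1 \<and> orientable_ribbon_graph G2 \<and>
        card (edges G1) < card (edges G) \<and> card (edges G2) < card (edges G) \<and>
        joinable G1 d1 G2 d2 \<and> G = join G1 d1 G2 d2)"

end

theory Submission
  imports Defs
begin

text \<open>
  In the exponents the number of components cancels: with \<open>f A\<close> the number of boundary components
  of \<open>(V, A)\<close>, \<open>\<sigma> A = (|V| + |A| - f A) / 2\<close>, and \<open>f A\<close> is the number of orbits of
  the rotation \<open>\<rho>\<close> composed with the transpositions that swap the two darts of each edge of \<open>A\<close>.

  Call a set \<open>I\<close> of darts separating if it is a proper nonempty union of edges and \<open>\<rho>\<close> leaves \<open>I\<close>
  from at most one dart.  No exit means disconnected, one exit means a join.  The orbits inside \<open>I\<close>
  do not depend on what happens outside, so \<open>\<sigma>\<close> is additive and \<open>R\<close> is a product of two such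
  polynomials.  Both vanish at \<open>x = y = 0\<close>, so neither is a unit.

  Conversely let \<open>R = P Q\<close> with \<open>n\<close> edges.  On the curve \<open>(x - 1) (y - 1) = 1\<close> the polynomial \<open>R\<close>
  equals \<open>x\<^sup>n\<close> up to a power of \<open>x - 1\<close>.  If one of the factors does not vanish at
  \<open>x = 0\<close> on that curve, the other one carries all of \<open>x\<^sup>n\<close>, and comparing degrees in \<open>x\<close> and
  \<open>y\<close> shows that the first is constant.  Otherwise both vanish at the origin, and then the
  coefficient of \<open>x\<close> in \<open>R\<close> is zero.  Up to sign, that coefficient is half the alternating sum of
  \<open>f A\<close>.  This sum only changes sign when \<open>\<rho>\<close> is composed with an edge transposition, so if there
  is no separating set we may assume that \<open>\<rho>\<close> is a single cycle, and the edges form a chord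
  diagram.  For two crossing chords \<open>a\<close>, \<open>b\<close>, deleting \<open>a\<close> from the diagram of \<open>\<rho>\<close> and from that of
  \<open>\<rho> a b\<close> gives two diagrams whose sums add up to the sum for \<open>\<rho>\<close>; hence all sums have the same sign
  and the sum is nonzero if the chords can be added one by one, each crossing an earlier one.  If
  they cannot, the gaps of a maximal such family of chords provide a separating set.
\<close>

section \<open>Orbits of permutations\<close>

lemma permutes_orbit_self:
  assumes "p permutes S" "finite S" shows "x \<in> orbit p x"
  by (rule permutation_self_in_orbit) (use assms permutation_permutes in auto)

lemma permutes_orbit_eq:
  assumes "p permutes S" "finite S" "y \<in> orbit p x" shows "orbit p y = orbit p x"
  by (rule orbit_cyclic_eq3[OF cyclic_on_orbit[OF assms(1,2)] assms(3)])

lemma orbit_invariant_subset: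
  assumes "x \<in> S" "\<And>y. y \<in> S \<Longrightarrow> p y \<in> S" shows "orbit p x \<subseteq> S"
proof
  fix y assume "y \<in> orbit p x" then show "y \<in> S" by induction (use assms in auto)
qed

definition num_orbits :: "'a set \<Rightarrow> ('a \<Rightarrow> 'a) \<Rightarrow> nat" where
  "num_orbits D p = card (orbit p ` D)"

context
  fixes p :: "'a \<Rightarrow> 'a" and D :: "'a set" and a b :: 'a
  assumes p: "p permutes D" and fin: "finite D" and aD: "a \<in> D" and bD: "b \<in> D"
begin

lemma permutes_comp_transpose: "p \<circ> transpose a b permutes D"
  by (rule permutes_compose[OF permutes_swap_id[OF aD bD] p])

text \<open>The new permutation sends \<open>a\<close> to \<open>p b\<close> and \<open>b\<close> to
  \<open>p a\<close> and is \<open>p\<close> elsewhere, which splices the two cycles into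
  one.\<close>

lemma orbit_comp_transpose_join:
  assumes "b \<notin> orbit p a"
  shows "orbit (p \<circ> transpose a b) a = orbit p a \<union> orbit p b"
proof
  note self = permutes_orbit_self[OF p fin] and eq = permutes_orbit_eq[OF p fin]
  note eq' = permutes_orbit_eq[OF permutes_comp_transpose fin]
  \<comment> \<open>From \<open>u\<close> the new permutation jumps to \<open>p v\<close> and
    follows the cycle of \<open>v\<close>. It could deviate only at \<open>v\<close>, when the whole
    cycle has been visited.\<close>
  have half: "orbit p v \<subseteq> orbit (p \<circ> transpose u v) u" if "v \<notin> orbit p u" for u v
  proof
    have "u \<notin> orbit p v" using that eq[of u v] self[of v] by auto
    fix y assume "y \<in> orbit p v"
    then show "y \<in> orbit (p \<circ> transpose u v) u"
    proof induction
      case base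
      show ?case by (rule orbit_eqI(1)) simp
    next
      case (step y)
      show ?case
      proof (cases "y = v")
        case True
        then show ?thesis by (intro orbit_eqI(1)) simp
      next
        case False
        moreover have "y \<noteq> u" using step \<open>u \<notin> orbit p v\<close> by auto
        ultimately have "(p \<circ> transpose u v) y = p y" by simp
        then show ?thesis using orbit.step[OF step.IH] by simp
      qed
    qed
  qed
  have "a \<notin> orbit p b" using assms eq[of a b] self[of b] by auto
  then have "orbit p a \<subseteq> orbit (p \<circ> transpose a b) b"
    using half[of a b] by (simp add: transpose_commute)
  moreover have "orbit p b \<subseteq> orbit (p \<circ> transpose a b) a"
    using half[OF assms] .
  moreover have "orbit (p \<circ> transpose a b) b = orbit (p \<circ> transpose a b) a"
    using calculation(2) self[of b] eq'[of b a] by blast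
  ultimately show "orbit p a \<union> orbit p b \<subseteq> orbit (p \<circ> transpose a b) a" by simp
  show "orbit (p \<circ> transpose a b) a \<subseteq> orbit p a \<union> orbit p b"
  proof (rule orbit_invariant_subset)
    show "a \<in> orbit p a \<union> orbit p b" using self[of a] by blast
    fix y assume "y \<in> orbit p a \<union> orbit p b"
    then show "(p \<circ> transpose a b) y \<in> orbit p a \<union> orbit p b"
      using orbit.base[of p] orbit.step[of _ p] by (auto simp: transpose_def)
  qed
qed

text \<open>Since \<open>a\<close> is now followed by \<open>p b\<close>, the stretch
  \<open>Y\<close> of the cycle from \<open>p b\<close> to \<open>a\<close> closes up, and it leaves
  out \<open>b\<close>.\<close>

lemma orbit_comp_transpose_split:
  assumes "b \<in> orbit p a" "a \<noteq> b"
  shows "b \<notin> orbit (p \<circ> transpose a b) a"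
proof -
  define k where "k = funpow_dist1 p b a"
  have ab: "a \<in> orbit p b"
    using permutes_orbit_eq[OF p fin assms(1)] permutes_orbit_self[OF p fin, of a] by simp
  define Y where "Y = (\<lambda>i. (p ^^ i) b) ` {0<..k}"
  have k: "(p ^^ k) b = a" unfolding k_def by (rule funpow_dist1_prop[OF ab])
  have k0: "0 < k" by (simp add: k_def)
  have ne: "(p ^^ i) b \<noteq> b" if "0 < i" "i < k" for i
    using funpow_neq_less_funpow_dist1[OF ab, of i 0] that by (auto simp: k_def)
  have nea: "(p ^^ i) b \<noteq> a" if "0 < i" "i < k" for i
    using funpow_dist1_least[of i p b a] that by (simp add: k_def)
  have "(p ^^ i) b \<noteq> b" if "i \<in> {0<..k}" for i
  proof (cases "i = k")
    case True
    then have "(p ^^ i) b = a" using k by simp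
    then show ?thesis using assms(2) by simp
  next
    case False
    then show ?thesis using ne[of i] that by simp
  qed
  then have bY: "y \<noteq> b" if "y \<in> Y" for y using that unfolding Y_def by (elim imageE) simp
  have Y: "(p ^^ i) b \<in> Y" if "0 < i" "i \<le> k" for i
    unfolding Y_def by (rule imageI) (use that in simp)
  have "(p \<circ> transpose a b) ((p ^^ i) b) \<in> Y" if "i \<in> {0<..k}" for i
  proof (cases "i = k")
    case True
    have "(p \<circ> transpose a b) ((p ^^ i) b) = (p ^^ 1) b" unfolding True k by simp
    then show ?thesis using Y[of 1] k0 by simp
  next
    case False
    then have i: "0 < i" "i < k" using that by simp_all
    have "(p \<circ> transpose a b) ((p ^^ i) b) = (p ^^ Suc i) b" using ne[OF i] nea[OF i] by simp
    then show ?thesis using Y[of "Suc i"] i by (simp only:)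
  qed
  then have "(p \<circ> transpose a b) y \<in> Y" if "y \<in> Y" for y
    using that unfolding Y_def by (elim imageE) simp
  moreover have "a \<in> Y" using Y[OF k0] k by simp
  ultimately have "orbit (p \<circ> transpose a b) a \<subseteq> Y" by (intro orbit_invariant_subset)
  then show ?thesis using bY by blast
qed

lemma num_orbits_comp_transpose_join:
  assumes "b \<notin> orbit p a"
  shows "num_orbits D p = Suc (num_orbits D (p \<circ> transpose a b))"
proof -
  note self = permutes_orbit_self[OF p fin] and eq = permutes_orbit_eq[OF p fin]
  define q where "q = p \<circ> transpose a b"
  define U where "U = orbit p a \<union> orbit p b"
  define R where "R = orbit p ` (D - U)"
  have q: "q permutes D" unfolding q_def by (rule permutes_comp_transpose)
  have qU: "orbit q a = U" unfolding q_def U_def by (rule orbit_comp_transpose_join[OF assms])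
  have sub: "U \<subseteq> D"
    unfolding U_def using permutes_orbit_subset[OF p] aD bD by blast
  have in_U: "orbit q x = U" if "x \<in> U" for x
    using that qU permutes_orbit_eq[OF q fin] by blast
  have out_U: "orbit q x = orbit p x" if "x \<notin> U" for x
  proof (rule orbit_cong[OF self])
    fix y assume "y \<in> orbit p x"
    then have "orbit p y = orbit p x" by (rule eq)
    moreover have "x \<notin> orbit p a" "x \<notin> orbit p b" using that by (auto simp: U_def)
    ultimately have "y \<noteq> a" "y \<noteq> b" using self by blast+
    then show "q y = p y" by (simp add: q_def)
  qed
  have notin: "X \<inter> U = {}" if "X \<in> R" for X
  proof (rule ccontr)
    assume "X \<inter> U \<noteq> {}"
    obtain x where x: "X = orbit p x" "x \<notin> U" using \<open>X \<in> R\<close> by (auto simp: R_def)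
    obtain y where y: "y \<in> orbit p x" "y \<in> orbit p a \<or> y \<in> orbit p b"
      using \<open>X \<inter> U \<noteq> {}\<close> x by (auto simp: U_def)
    then have "x \<in> orbit p a \<or> x \<in> orbit p b" using eq self by metis
    then show False using x by (auto simp: U_def)
  qed
  have finR: "finite R" using fin by (auto simp: R_def)
  have "orbit q ` D = insert U R"
  proof -
    have "orbit q ` D = orbit q ` U \<union> orbit q ` (D - U)" using sub by blast
    moreover have "orbit q ` U = {U}" using in_U self by (force simp: U_def)
    moreover have "orbit q ` (D - U) = R" unfolding R_def by (rule image_cong) (use out_U in auto)
    ultimately show ?thesis by simp
  qed
  moreover have "U \<notin> R" using notin[of U] self by (auto simp: U_def)
  ultimately have q_card: "num_orbits D q = Suc (card R)"
    using finR by (simp add: num_orbits_def)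
  have "orbit p ` D = orbit p ` U \<union> orbit p ` (D - U)" using sub by blast
  moreover have "orbit p ` U = {orbit p a, orbit p b}"
  proof -
    have "orbit p ` U \<subseteq> {orbit p a, orbit p b}" unfolding U_def using eq by blast
    moreover have "a \<in> U" "b \<in> U" using self by (auto simp: U_def)
    ultimately show ?thesis by blast
  qed
  ultimately have "orbit p ` D = insert (orbit p a) (insert (orbit p b) R)" by (simp add: R_def)
  moreover have "orbit p a \<notin> R" "orbit p b \<notin> R"
    using notin[of "orbit p a"] notin[of "orbit p b"] self by (auto simp: U_def)
  moreover have "orbit p a \<noteq> orbit p b" using assms self by blast
  ultimately show ?thesis using finR q_card by (simp add: num_orbits_def flip: q_def)
qed

end

lemma num_orbits_comp_transpose:
  assumes p: "p permutes D" and fin: "finite D" and ab: "a \<in> D" "b \<in> D" "a \<noteq> b"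
  shows "int (num_orbits D (p \<circ> transpose a b)) =
    int (num_orbits D p) + (if b \<in> orbit p a then 1 else -1)"
proof (cases "b \<in> orbit p a")
  case True
  define q where "q = p \<circ> transpose a b"
  have q: "q permutes D" unfolding q_def by (rule permutes_comp_transpose[OF p fin ab(1,2)])
  \<comment> \<open>Splitting is joining read backwards: \<open>a\<close> and \<open>b\<close> lie
    on different cycles of \<open>q\<close>, and the same transposition restores
    \<open>p\<close>.\<close>
  have "b \<notin> orbit q a" unfolding q_def by (rule orbit_comp_transpose_split[OF p fin ab(1,2) True ab(3)])
  then have "num_orbits D q = Suc (num_orbits D (q \<circ> transpose a b))"
    by (rule num_orbits_comp_transpose_join[OF q fin ab(1,2)])
  moreover have "q \<circ> transpose a b = p" by (simp add: fun_eq_iff q_def)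
  ultimately show ?thesis using True unfolding q_def by simp
next
  case False
  then show ?thesis using num_orbits_comp_transpose_join[OF p fin ab(1,2) False] by simp
qed

section \<open>First-return maps of sets with one exit\<close>

lemma orbit_subset_of_step:
  assumes "p x \<in> S" "\<And>y. y \<in> S \<Longrightarrow> p y \<in> S" shows "orbit p x \<subseteq> S"
proof
  fix y assume "y \<in> orbit p x" then show "y \<in> S" by induction (use assms in auto)
qed

text \<open>\<open>p\<close> maps \<open>I - {x0}\<close> injectively into \<open>I\<close>, so
  exactly one point of \<open>I\<close> is not covered from inside. It is the only place where
  \<open>I\<close> can be entered.\<close>

lemma unique_entry:
  assumes p: "p permutes D" and fin: "finite I" and x0: "x0 \<in> I" "p x0 \<notin> I"
    and ex: "\<And>x. x \<in> I \<Longrightarrow> x \<noteq> x0 \<Longrightarrow> p x \<in> I"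
  obtains z where "I - p ` (I - {x0}) = {z}"
proof -
  have "card (p ` (I - {x0})) = card I - 1"
    using card_image[OF inj_on_subset[OF permutes_inj[OF p] subset_UNIV]] x0 fin by simp
  moreover have "p ` (I - {x0}) \<subseteq> I" using ex by blast
  moreover have "card I > 0" using x0 fin card_gt_0_iff by blast
  ultimately have "card (I - p ` (I - {x0})) = 1"
    using card_Diff_subset[of "p ` (I - {x0})" I] fin by simp
  then show ?thesis using that card_1_singletonE by metis
qed

text \<open>The only other candidate for a preimage of \<open>z\<close> inside \<open>I\<close> is
  \<open>x0\<close>, which leaves \<open>I\<close>. Any entry from outside lands, by injectivity, on
  a point not covered from inside.\<close>

lemma unique_entry_point:
  assumes p: "p permutes D" and x0: "p x0 \<notin> I" and z: "I - p ` (I - {x0}) = {z}"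
  shows "inv p z \<notin> I" "p (inv p z) = z" "\<And>y. y \<notin> I \<Longrightarrow> p y \<in> I \<Longrightarrow> y = inv p z"
proof -
  show pz: "p (inv p z) = z" using permutes_inverses(1)[OF p] by simp
  have img: "z \<notin> p ` (I - {x0})" "z \<in> I" using z by auto
  show "inv p z \<notin> I"
  proof
    assume "inv p z \<in> I"
    then show False using img x0 pz by (cases "inv p z = x0") force+
  qed
  show "y = inv p z" if "y \<notin> I" "p y \<in> I" for y
  proof -
    have "p y \<noteq> p w" if "w \<in> I" for w
      using that \<open>y \<notin> I\<close> inj_eq[OF permutes_inj[OF p], of y w] by auto
    then have "p y \<in> I - p ` (I - {x0})" using \<open>p y \<in> I\<close> by auto
    then have "p y = p (inv p z)" using z pz by simp
    then show ?thesis using inj_eq[OF permutes_inj[OF p]] by simp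
  qed
qed

text \<open>\<open>r\<close> is the first-return map of \<open>p\<close> to \<open>I\<close>: every
  excursion out of \<open>I\<close> starts at \<open>x0\<close> and comes back at
  \<open>p y0\<close>, so \<open>r\<close> merely skips the part of a cycle outside
  \<open>I\<close>.\<close>

lemma orbit_first_return:
  assumes p: "p permutes D" and fin: "finite D" and I: "I \<subseteq> D"
    and x0: "x0 \<in> I" "p x0 \<notin> I" and ex: "\<And>x. x \<in> I \<Longrightarrow> x \<noteq> x0 \<Longrightarrow> p x \<in> I"
    and y0: "y0 \<notin> I" "p y0 \<in> I" and en: "\<And>y. y \<notin> I \<Longrightarrow> p y \<in> I \<Longrightarrow> y = y0"
    and r: "\<And>x. x \<in> I \<Longrightarrow> x \<noteq> x0 \<Longrightarrow> r x = p x" "r x0 = p y0"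
    and x: "x \<in> I"
  shows "orbit r x = orbit p x \<inter> I"
proof
  have rI: "r y \<in> I" if "y \<in> I" for y
    using that r ex y0 by (cases "y = x0") auto
  \<comment> \<open>Excursions end: otherwise the cycle of \<open>x0\<close> would stay outside
    \<open>I\<close> from \<open>p x0\<close> on, yet it returns to \<open>x0\<close>.\<close>
  have y0_orbit: "y0 \<in> orbit p x0"
  proof (rule ccontr)
    assume no: "y0 \<notin> orbit p x0"
    have "orbit p (p x0) \<subseteq> orbit p x0 - I"
    proof (rule orbit_invariant_subset)
      show "p x0 \<in> orbit p x0 - I" using x0 by (simp add: orbit.base)
      fix y assume "y \<in> orbit p x0 - I"
      then show "p y \<in> orbit p x0 - I" using no en[of y] orbit.step[of y p x0] by auto
    qed
    moreover have "x0 \<in> orbit p (p x0)"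
      using permutes_orbit_eq[OF p fin orbit.base[of p x0]] permutes_orbit_self[OF p fin, of x0] by simp
    ultimately show False using x0 by auto
  qed
  have step: "r y \<in> orbit p x" if "y \<in> I" "y = x \<or> y \<in> orbit p x" for y
  proof -
    have y: "y \<in> orbit p x" using that(2) permutes_orbit_self[OF p fin, of x] by auto
    show ?thesis
    proof (cases "y = x0")
      case True
      then show ?thesis
        using orbit.step[OF y0_orbit] permutes_orbit_eq[OF p fin y] r(2) by simp
    next
      case False
      then show ?thesis using orbit.step[OF y] r(1)[OF that(1)] by simp
    qed
  qed
  show "orbit r x \<subseteq> orbit p x \<inter> I"
  proof (rule orbit_subset_of_step)
    show "r x \<in> orbit p x \<inter> I" using step[OF x] rI[OF x] by simp
    fix y assume "y \<in> orbit p x \<inter> I"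
    then show "r y \<in> orbit p x \<inter> I" using step[of y] rI[of y] by simp
  qed
  \<comment> \<open>\<open>r\<close> is not known to be a permutation here, and
    \<open>orbit r x\<close> starts at \<open>r x\<close>, so \<open>x\<close> is treated separately
    from \<open>S\<close>.\<close>
  define S where "S = orbit r x"
  have S: "r y \<in> S" if "y = x \<or> y \<in> S" for y
    using that orbit.base[of r x] orbit.step[of y r x] by (auto simp: S_def)
  have SI: "y \<in> I" if "y \<in> S" for y
    using orbit_subset_of_step[of r x I, OF rI[OF x] rI] that by (auto simp: S_def)
  \<comment> \<open>Once \<open>x0\<close> is reached, the whole complement of \<open>I\<close> is
    added. The result is closed under \<open>p\<close>, since the only way back leads to
    \<open>p y0 = r x0\<close>, and nothing new lies inside \<open>I\<close>.\<close>
  define T where "T = S \<union> (if x = x0 \<or> x0 \<in> S then D - I else {})"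
  have pS: "p y \<in> T" if "y = x \<or> y \<in> S" for y
  proof (cases "y = x0")
    case True
    then have "x = x0 \<or> x0 \<in> S" using that by blast
    moreover have "p x0 \<in> D - I" using permutes_in_image[OF p] x0 I by auto
    ultimately show ?thesis using True by (simp add: T_def)
  next
    case False
    moreover have "y \<in> I" using that x SI by blast
    ultimately show ?thesis using S[OF that] r(1)[of y] by (simp add: T_def)
  qed
  have "orbit p x \<subseteq> T"
  proof (rule orbit_subset_of_step)
    show "p x \<in> T" using pS by blast
    fix y assume y: "y \<in> T"
    show "p y \<in> T"
    proof (cases "y \<in> S")
      case True
      then show ?thesis using pS by blast
    next
      case False
      then have *: "x = x0 \<or> x0 \<in> S" "y \<in> D - I" using y by (auto simp: T_def split: if_splits)
      show ?thesis
      proof (cases "p y \<in> I")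
        case True
        then have "p y = r x0" using en[of y] * r(2) by simp
        moreover have "r x0 \<in> S" using S[of x0] *(1) by blast
        ultimately show ?thesis by (simp add: T_def)
      next
        case False
        then show ?thesis using * permutes_in_image[OF p, of y] by (simp add: T_def)
      qed
    qed
  qed
  then show "orbit p x \<inter> I \<subseteq> orbit r x" unfolding T_def S_def[symmetric] by (auto split: if_splits)
qed

text \<open>With an exit \<open>x0\<close>, both traces are orbits of the same map
  \<open>p(x0 := z)\<close>, because the point \<open>z\<close> not covered from inside depends only
  on the values on \<open>I\<close>. Without an exit the orbits themselves agree.\<close>

lemma orbit_Int_cong:
  assumes p: "p permutes D" and q: "q permutes D" and fin: "finite D" and I: "I \<subseteq> D"
    and exp: "\<And>x y. x \<in> I \<Longrightarrow> y \<in> I \<Longrightarrow> p x \<notin> I \<Longrightarrow> p y \<notin> I \<Longrightarrow> x = y"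
    and eq: "\<And>x. x \<in> I \<Longrightarrow> p x = q x" and x: "x \<in> I"
  shows "orbit p x \<inter> I = orbit q x \<inter> I"
proof (cases "\<exists>x0\<in>I. p x0 \<notin> I")
  case False
  then have "orbit p x = orbit q x" by (intro orbit_cong0[OF x _ eq]) auto
  then show ?thesis by simp
next
  case True
  then obtain x0 where x0: "x0 \<in> I" "p x0 \<notin> I" by blast
  have ex: "p x \<in> I" if "x \<in> I" "x \<noteq> x0" for x using exp[OF that(1) x0(1)] x0(2) that(2) by blast
  have finI: "finite I" using I fin finite_subset by blast
  obtain z where z: "I - p ` (I - {x0}) = {z}" using unique_entry[OF p finI x0 ex] by blast
  have "orbit (p(x0 := z)) x = orbit s x \<inter> I"
    if s: "s permutes D" and es: "\<And>x. x \<in> I \<Longrightarrow> s x = p x" for s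
  proof (rule orbit_first_return[OF s fin I x0(1)])
    show "s x0 \<notin> I" using x0 es by simp
    show "s x \<in> I" if "x \<in> I" "x \<noteq> x0" for x using ex[OF that] es[OF that(1)] by simp
    have "s ` (I - {x0}) = p ` (I - {x0})" using es by (intro image_cong) auto
    then have zs: "I - s ` (I - {x0}) = {z}" using z by simp
    have out: "s x0 \<notin> I" using x0 es by simp
    note entry = unique_entry_point[OF s out zs]
    show "inv s z \<notin> I" by (rule entry(1))
    show "s (inv s z) \<in> I" using entry(2) z by auto
    show "y = inv s z" if "y \<notin> I" "s y \<in> I" for y by (rule entry(3)[OF that])
    show "(p(x0 := z)) x = s x" if "x \<in> I" "x \<noteq> x0" for x using that es by simp
    show "(p(x0 := z)) x0 = s (inv s z)" using entry(2) by simp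
    show "x \<in> I" by (rule x)
  qed
  from this[OF p] this[OF q] show ?thesis using eq by simp
qed

section \<open>Alternating orbit counts of a dart pairing\<close>

lemma sum_Pow_insert:
  assumes "finite F" "a \<notin> F"
  shows "(\<Sum>A\<in>Pow (insert a F). g A) = (\<Sum>A\<in>Pow F. g A) + (\<Sum>A\<in>Pow F. g (insert a A))"
proof -
  have "inj_on (insert a) (Pow F)"
  proof (rule inj_onI)
    fix A B assume "A \<in> Pow F" "B \<in> Pow F" "insert a A = insert a B"
    then show "A = B" using insert_ident[of a A B] assms(2) by fast
  qed
  moreover have "Pow F \<inter> insert a ` Pow F = {}" using assms(2) by fast
  ultimately show ?thesis
    unfolding Pow_insert using assms(1) by (simp add: sum.union_disjoint sum.reindex)
qed

lemma sum_minus_one_power_card_Pow: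
  assumes "finite F" "F \<noteq> {}"
  shows "(\<Sum>A\<in>Pow F. (- 1) ^ card A) = (0 :: 'a :: comm_ring_1)"
  using assms
proof (induction F rule: finite_ne_induct)
  case (singleton x)
  then show ?case by (simp add: Pow_insert)
next
  case (insert x F)
  have "(\<Sum>A\<in>Pow F. (- 1) ^ card (insert x A)) = (\<Sum>A\<in>Pow F. - ((- 1) ^ card A) :: 'a)"
  proof (rule sum.cong[OF refl])
    fix A assume "A \<in> Pow F"
    then have "A \<subseteq> F" by simp
    then have "finite A" "x \<notin> A" using insert.hyps finite_subset[of A F] by auto
    then show "(- 1) ^ card (insert x A) = - ((- 1) ^ card A :: 'a)" by simp
  qed
  then show ?case
    unfolding sum_Pow_insert[OF insert.hyps(1,3)] insert.IH sum_negf by simp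
qed

section \<open>Darts paired into edges, with a variable permutation\<close>

locale dart_pairing =
  fixes D :: "'d set" and opp :: "'d \<Rightarrow> 'd"
  assumes fin: "finite D" and opp_permutes: "opp permutes D"
    and opp_neq: "d \<in> D \<Longrightarrow> opp d \<noteq> d" and opp_opp: "d \<in> D \<Longrightarrow> opp (opp d) = d"
begin

definition E :: "'d set set" where "E = {{d, opp d} |d. d \<in> D}"

text \<open>The product of the transpositions of the two ends of each edge in \<open>A\<close>. For
  a rotation \<open>p\<close>, the cycles of \<open>p \<circ> flip A\<close> are the boundary
  components that contain darts.\<close>

definition flip :: "'d set set \<Rightarrow> 'd \<Rightarrow> 'd" where
  "flip A d = (if d \<in> \<Union>A then opp d else d)"

text \<open>For an edge this decides whether its flip splits one cycle of \<open>p\<close> or merges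
  two.\<close>

definition tied :: "('d \<Rightarrow> 'd) \<Rightarrow> 'd set \<Rightarrow> bool" where
  "tied p e \<longleftrightarrow> (\<forall>x\<in>e. \<forall>y\<in>e. y \<in> orbit p x)"

lemma opp_in: "d \<in> D \<Longrightarrow> opp d \<in> D"
  using permutes_in_image[OF opp_permutes] by simp

lemma edge_of: assumes "e \<in> E" "d \<in> e" shows "e = {d, opp d}" "d \<in> D" "opp d \<in> D"
  using assms opp_in opp_opp by (auto simp: E_def)

lemma edgeE: assumes "e \<in> E" obtains d where "d \<in> D" "opp d \<in> D" "e = {d, opp d}"
  using assms opp_in by (auto simp: E_def)

lemma finite_E: "finite E"
  using fin by (simp add: E_def)

lemma in_Union_iff: assumes "A \<subseteq> E" shows "d \<in> \<Union>A \<longleftrightarrow> d \<in> D \<and> {d, opp d} \<in> A"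
  using assms edge_of by blast

lemma opp_in_Union: assumes "A \<subseteq> E" "d \<in> \<Union>A" shows "opp d \<in> \<Union>A"
  using assms edge_of by blast

lemma Union_subset: assumes "A \<subseteq> E" shows "\<Union>A \<subseteq> D"
  using in_Union_iff[OF assms] by blast

lemma Union_E: "\<Union>E = D"
  by (auto simp: E_def opp_in)

lemma edges_disjoint: assumes "e \<in> E" "f \<in> E" "e \<noteq> f" shows "e \<inter> f = {}"
proof (rule ccontr)
  assume "e \<inter> f \<noteq> {}"
  then obtain d where "d \<in> e" "d \<in> f" by blast
  then show False using edge_of(1)[OF assms(1)] edge_of(1)[OF assms(2)] assms(3) by metis
qed

lemma flip_flip: assumes "A \<subseteq> E" shows "flip A (flip A d) = d"
proof (cases "d \<in> \<Union>A")
  case True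
  then show ?thesis
    using opp_in_Union[OF assms True] Union_subset[OF assms] opp_opp[of d] unfolding flip_def by (simp only: if_True subsetD)
next
  case False
  then show ?thesis unfolding flip_def by simp
qed

lemma flip_permutes: assumes "A \<subseteq> E" shows "flip A permutes D"
  unfolding permutes_def
proof (intro conjI allI impI)
  fix x assume "x \<notin> D"
  then show "flip A x = x" using Union_subset[OF assms] by (auto simp: flip_def)
next
  fix y show "\<exists>!x. flip A x = y" using flip_flip[OF assms] by metis
qed

lemma flip_empty: "flip {} = id"
  by (simp add: flip_def fun_eq_iff)

lemma flip_edge: assumes "d \<in> D" shows "flip {{d, opp d}} = transpose d (opp d)"
  using assms opp_opp by (auto simp: flip_def fun_eq_iff transpose_def)

text \<open>Distinct edges are disjoint, so their flips commute.\<close>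

lemma flip_insert:
  assumes "e \<in> E" "A \<subseteq> E" "e \<notin> A"
  shows "flip (insert e A) = flip {e} \<circ> flip A" "flip (insert e A) = flip A \<circ> flip {e}"
proof -
  have *: "flip (insert e A) x = flip {e} (flip A x) \<and> flip (insert e A) x = flip A (flip {e} x)" for x
  proof (cases "x \<in> e")
    case True
    then have "opp x \<in> e" using edge_of[OF assms(1) True] by blast
    then have "x \<notin> \<Union>A" "opp x \<notin> \<Union>A" using True assms edges_disjoint[of e] by blast+
    then show ?thesis using True by (simp add: flip_def)
  next
    case False
    have "opp x \<notin> e" if "x \<in> \<Union>A"
      using opp_in_Union[OF assms(2) that] assms edges_disjoint[of e] by blast
    then show ?thesis using False by (simp add: flip_def)
  qed
  show "flip (insert e A) = flip {e} \<circ> flip A" by (simp add: fun_eq_iff conjunct1[OF *])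
  show "flip (insert e A) = flip A \<circ> flip {e}" by (simp add: fun_eq_iff conjunct2[OF *])
qed

lemma flip_edge_twice: assumes "e \<in> E" shows "p \<circ> flip {e} \<circ> flip {e} = p"
  using assms by (simp add: fun_eq_iff flip_flip)

lemma comp_flip_permutes: assumes "p permutes D" "A \<subseteq> E" shows "p \<circ> flip A permutes D"
  by (rule permutes_compose[OF flip_permutes[OF assms(2)] assms(1)])

lemma comp_flip_edge_permutes: assumes "p permutes D" "e \<in> E" shows "p \<circ> flip {e} permutes D"
  by (rule comp_flip_permutes) (use assms in auto)

lemma tied_iff:
  assumes "p permutes D" shows "tied p {d, opp d} \<longleftrightarrow> opp d \<in> orbit p d"
  using permutes_orbit_self[OF assms fin] permutes_orbit_eq[OF assms fin, of "opp d" d]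
  by (auto simp: tied_def)

lemma num_orbits_flip:
  assumes "p permutes D" "e \<in> E"
  shows "int (num_orbits D (p \<circ> flip {e})) = int (num_orbits D p) + (if tied p e then 1 else - 1)"
proof -
  obtain d where d: "d \<in> D" "opp d \<in> D" "e = {d, opp d}" using assms edgeE by metis
  show ?thesis
    unfolding d(3) flip_edge[OF d(1)] tied_iff[OF assms(1)]
    by (rule num_orbits_comp_transpose[OF assms(1) fin d(1,2)]) (use opp_neq[OF d(1)] in simp)
qed

lemma num_orbits_1_in_orbit:
  assumes "p permutes D" "num_orbits D p = 1" "x \<in> D" "y \<in> D" shows "y \<in> orbit p x"
proof -
  obtain X where X: "orbit p ` D = {X}" using assms(2) card_1_singletonE unfolding num_orbits_def by blast
  then have "orbit p x = X" "orbit p y = X" using assms(3,4) by blast+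
  then show ?thesis using permutes_orbit_self[OF assms(1) fin, of y] by simp
qed

lemma num_orbits_1_tied:
  assumes "p permutes D" "num_orbits D p = 1" "e \<in> E" shows "tied p e"
  unfolding tied_def using num_orbits_1_in_orbit[OF assms(1,2)] edge_of(2)[OF assms(3)] by simp

text \<open>For at least two edges and \<open>F = E\<close>, half of this is, up to sign, the
  coefficient of \<open>x\<close> in the polynomial. The leading minus gives one chord on a single
  cycle the value 1.\<close>

definition orbit_sum :: "('d \<Rightarrow> 'd) \<Rightarrow> 'd set set \<Rightarrow> int" where
  "orbit_sum p F = - (\<Sum>A\<in>Pow F. (- 1) ^ card A * int (num_orbits D (p \<circ> flip A)))"

text \<open>When \<open>p\<close> is a single cycle, flipping \<open>a\<close> cuts it into two, and
  \<open>b\<close> has an end on each exactly when the chords interlace.\<close>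

definition cross :: "('d \<Rightarrow> 'd) \<Rightarrow> 'd set \<Rightarrow> 'd set \<Rightarrow> bool" where
  "cross p a b \<longleftrightarrow> \<not> tied (p \<circ> flip {a}) b"

lemma orbit_sum_insert:
  assumes "a \<in> E" "F \<subseteq> E" "a \<notin> F"
  shows "orbit_sum p (insert a F) = orbit_sum p F - orbit_sum (p \<circ> flip {a}) F"
proof -
  have finF: "finite F" using assms(2) finite_E finite_subset by blast
  have "(- 1) ^ card (insert a A) * int (num_orbits D (p \<circ> flip (insert a A)))
      = - ((- 1) ^ card A * int (num_orbits D (p \<circ> flip {a} \<circ> flip A)))" if "A \<in> Pow F" for A
  proof -
    have "finite A" "a \<notin> A" "A \<subseteq> E" using that assms finF finite_subset[of A F] by auto
    then show ?thesis using flip_insert(1)[of a A] assms(1) by (simp add: comp_assoc)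
  qed
  then show ?thesis
    unfolding orbit_sum_def sum_Pow_insert[OF finF assms(3)] by (simp add: sum_negf)
qed

text \<open>Composing with \<open>flip {b}\<close> exchanges the terms with \<open>b\<close> and
  those without it, which carry opposite signs.\<close>

lemma orbit_sum_flip:
  assumes "b \<in> F" "F \<subseteq> E"
  shows "orbit_sum (p \<circ> flip {b}) F = - orbit_sum p F"
proof -
  define G where "G = F - {b}"
  have G: "F = insert b G" "b \<in> E" "G \<subseteq> E" "b \<notin> G" using assms by (auto simp: G_def)
  show ?thesis unfolding G(1) orbit_sum_insert[OF G(2-4)] flip_edge_twice[OF G(2)] by simp
qed

text \<open>The flip of \<open>b\<close> turns the minus of \<open>orbit_sum_insert\<close> into a
  plus. If \<open>a\<close> and \<open>b\<close> cross on a single cycle, flipping both gives a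
  single cycle again, so induction applies to both terms.\<close>

lemma orbit_sum_insert_cross:
  assumes "a \<in> E" "F \<subseteq> E" "a \<notin> F" "b \<in> F"
  shows "orbit_sum p (insert a F) = orbit_sum p F + orbit_sum (p \<circ> flip {a} \<circ> flip {b}) F"
  using orbit_sum_insert[OF assms(1-3)] orbit_sum_flip[OF assms(4,2)] by simp

lemma num_orbits_cross:
  assumes "p permutes D" "num_orbits D p = 1" "a \<in> E" "b \<in> E" "cross p a b"
  shows "num_orbits D (p \<circ> flip {a} \<circ> flip {b}) = 1"
  using assms num_orbits_flip[OF comp_flip_edge_permutes[OF assms(1,3)] assms(4)]
    num_orbits_flip[OF assms(1,3)] num_orbits_1_tied[OF assms(1-3)]
  by (simp add: cross_def)

lemma num_orbits_tied:
  assumes "p permutes D" "num_orbits D p = 1" "a \<in> E"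
  shows "num_orbits D (p \<circ> flip {a}) = 2" "\<not> tied (p \<circ> flip {a}) a"
proof -
  show *: "num_orbits D (p \<circ> flip {a}) = 2"
    using num_orbits_flip[OF assms(1,3)] num_orbits_1_tied[OF assms] assms(2) by simp
  show "\<not> tied (p \<circ> flip {a}) a"
    using num_orbits_flip[OF comp_flip_edge_permutes[OF assms(1,3)] assms(3)] *
    by (auto simp: flip_edge_twice[OF assms(3)] assms(2) split: if_splits)
qed

lemma orbit_sum_single:
  assumes "p permutes D" "num_orbits D p = 1" "a \<in> E"
  shows "orbit_sum p {a} = 1"
proof -
  have "orbit_sum p {} = - 1" "orbit_sum (p \<circ> flip {a}) {} = - 2"
    using assms(2) num_orbits_tied(1)[OF assms] by (simp_all add: orbit_sum_def flip_empty)
  then show ?thesis using orbit_sum_insert[of a "{}" p] assms by simp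
qed

text \<open>Flipping \<open>a\<close> cuts the cycle in two, and every chord of \<open>F\<close>
  stays within one piece. So for each \<open>A \<subseteq> F\<close> the flip of \<open>a\<close>
  adds one cycle, and the alternating sum of this constant difference over the subsets of
  \<open>F\<close> is 0.\<close>

lemma orbit_sum_isolated:
  assumes p: "p permutes D" "num_orbits D p = 1" and a: "a \<in> E" "a \<notin> F" and F: "F \<subseteq> E" "F \<noteq> {}"
    and nc: "\<And>b. b \<in> F \<Longrightarrow> \<not> cross p a b"
  shows "orbit_sum p (insert a F) = 0"
proof -
  define q where "q = p \<circ> flip {a}"
  have q: "q permutes D" unfolding q_def by (rule comp_flip_edge_permutes[OF p(1) a(1)])
  obtain d where d: "d \<in> D" "opp d \<in> D" "a = {d, opp d}" using a(1) edgeE by metis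
  have od: "opp d \<notin> orbit q d"
    using num_orbits_tied(2)[OF p a(1)] tied_iff[OF q] d(3) by (simp add: q_def)
  have *: "int (num_orbits D (p \<circ> flip A)) = int (num_orbits D (q \<circ> flip A)) - 1" if "A \<subseteq> F" for A
  proof -
    have AE: "A \<subseteq> E" "a \<notin> A" using that F a by auto
    define r where "r = q \<circ> flip A"
    have r: "r permutes D" unfolding r_def by (rule comp_flip_permutes[OF q AE(1)])
    \<comment> \<open>No flip of a chord in \<open>A\<close> leads out of the cycle of
      \<open>d\<close> under \<open>q\<close>, so the ends of \<open>a\<close> remain apart.\<close>
    have "orbit r d \<subseteq> orbit q d"
    proof (rule orbit_invariant_subset)
      show "d \<in> orbit q d" by (rule permutes_orbit_self[OF q fin])
      fix y assume y: "y \<in> orbit q d"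
      have "flip A y \<in> orbit q d"
      proof (cases "y \<in> \<Union>A")
        case True
        then obtain b where b: "b \<in> A" "y \<in> b" by blast
        then have "opp y \<in> b" using edge_of[of b y] AE by blast
        moreover have "tied q b" using nc[of b] b that by (auto simp: cross_def q_def)
        ultimately have "opp y \<in> orbit q y" using b by (auto simp: tied_def)
        then show ?thesis using permutes_orbit_eq[OF q fin y] True by (simp add: flip_def)
      next
        case False
        then show ?thesis using y by (simp add: flip_def)
      qed
      then show "r y \<in> orbit q d" unfolding r_def by (simp add: orbit.step)
    qed
    then have "\<not> tied r a" using od tied_iff[OF r] d(3) by auto
    then have "int (num_orbits D (r \<circ> flip {a})) = int (num_orbits D r) - 1"
      using num_orbits_flip[OF r a(1)] by simp
    moreover have "flip {a} \<circ> flip A \<circ> flip {a} = flip A"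
      using flip_insert[OF a(1) AE] flip_edge_twice[OF a(1), of "flip A"] by simp
    then have "r \<circ> flip {a} = p \<circ> flip A"
      unfolding r_def q_def by (simp add: comp_assoc)
    ultimately show ?thesis by (simp add: r_def)
  qed
  have finF: "finite F" using F(1) finite_E finite_subset by blast
  have "orbit_sum p F - orbit_sum q F =
    (\<Sum>A\<in>Pow F. (- 1) ^ card A *
      (int (num_orbits D (q \<circ> flip A)) - int (num_orbits D (p \<circ> flip A))))"
    by (simp add: orbit_sum_def right_diff_distrib sum_subtractf)
  also have "\<dots> = (\<Sum>A\<in>Pow F. (- 1) ^ card A)" by (rule sum.cong) (use * in auto)
  also have "\<dots> = 0" by (rule sum_minus_one_power_card_Pow[OF finF F(2)])
  finally show ?thesis using orbit_sum_insert[OF a(1) F(1) a(2)] by (simp add: q_def)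
qed

text \<open>If the new chord crosses one of \<open>F\<close>, both terms of
  \<open>orbit_sum_insert_cross\<close> belong to single cycles; if it crosses none, the sum is
  0.\<close>

lemma orbit_sum_nonneg:
  assumes "finite F" "F \<noteq> {}" "F \<subseteq> E" "p permutes D" "num_orbits D p = 1"
  shows "orbit_sum p F \<ge> 0"
  using assms
proof (induction F arbitrary: p rule: finite_ne_induct)
  case (singleton a)
  then show ?case using orbit_sum_single by simp
next
  case (insert a F)
  have a: "a \<in> E" "F \<subseteq> E" using insert by auto
  show ?case
  proof (cases "\<exists>b\<in>F. cross p a b")
    case True
    then obtain b where b: "b \<in> F" "cross p a b" by blast
    then have "b \<in> E" using a by blast
    let ?q = "p \<circ> flip {a} \<circ> flip {b}"
    have "?q permutes D" using comp_flip_edge_permutes insert.prems(2) a \<open>b \<in> E\<close> by blast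
    moreover have "num_orbits D ?q = 1" using num_orbits_cross insert.prems a b \<open>b \<in> E\<close> by blast
    ultimately have "orbit_sum ?q F \<ge> 0" by (rule insert.IH[OF a(2)])
    moreover have "orbit_sum p F \<ge> 0" by (rule insert.IH[OF a(2) insert.prems(2,3)])
    ultimately show ?thesis
      unfolding orbit_sum_insert_cross[OF a \<open>a \<notin> F\<close> b(1)] by (rule add_nonneg_nonneg[rotated])
  next
    case False
    then show ?thesis using orbit_sum_isolated[of p a F] insert a by auto
  qed
qed

text \<open>Sets of chords whose interlacement graph is connected, built up chord by chord.\<close>

inductive interlaced :: "('d \<Rightarrow> 'd) \<Rightarrow> 'd set set \<Rightarrow> bool" for p where
  single: "a \<in> E \<Longrightarrow> interlaced p {a}"
| insert: "interlaced p K \<Longrightarrow> a \<in> E \<Longrightarrow> a \<notin> K \<Longrightarrow> b \<in> K \<Longrightarrow> cross p a b \<Longrightarrow> interlaced p (insert a K)"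

lemma interlaced_subset: "interlaced p K \<Longrightarrow> K \<subseteq> E \<and> K \<noteq> {}"
  by (induction rule: interlaced.induct) auto

text \<open>The term for \<open>p\<close> is positive by induction. Nothing is known about
  interlacing for the other permutation, but there nonnegativity is enough.\<close>

lemma orbit_sum_pos:
  assumes "interlaced p K" "p permutes D" "num_orbits D p = 1"
  shows "orbit_sum p K > 0"
  using assms
proof (induction rule: interlaced.induct)
  case (single a)
  then show ?case using orbit_sum_single by simp
next
  case (insert K a b)
  then have K: "K \<subseteq> E" "K \<noteq> {}" using interlaced_subset by auto
  then have b: "b \<in> E" using insert by blast
  let ?q = "p \<circ> flip {a} \<circ> flip {b}"
  have "?q permutes D" using comp_flip_edge_permutes insert.prems(1) insert.hyps(2) b by blast
  moreover have "num_orbits D ?q = 1" using num_orbits_cross insert b by blast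
  ultimately have "orbit_sum ?q K \<ge> 0"
    using orbit_sum_nonneg K finite_E finite_subset by blast
  then show ?case
    unfolding orbit_sum_insert_cross[OF insert.hyps(2) K(1) insert.hyps(3,4)] using insert by simp
qed

end

section \<open>Separating sets of darts\<close>

context dart_pairing begin

definition separated :: "('d \<Rightarrow> 'd) \<Rightarrow> 'd set \<Rightarrow> bool" where
  "separated p I \<longleftrightarrow> I \<subseteq> D \<and> I \<noteq> {} \<and> I \<noteq> D \<and> (\<forall>x\<in>I. opp x \<in> I) \<and>
     (\<forall>x\<in>I. \<forall>y\<in>I. p x \<notin> I \<longrightarrow> p y \<notin> I \<longrightarrow> x = y)"

lemma separated_flip_in:
  assumes "separated p I" "A \<subseteq> E" shows "flip A x \<in> I \<longleftrightarrow> x \<in> I"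
proof -
  have *: "flip A y \<in> I" if "y \<in> I" for y using that assms(1) by (simp add: separated_def flip_def)
  show ?thesis using *[of x] *[of "flip A x"] flip_flip[OF assms(2)] by auto
qed

lemma separated_flip:
  assumes "separated p I" "A \<subseteq> E" shows "separated (p \<circ> flip A) I"
  unfolding separated_def
proof (intro conjI ballI impI)
  show "I \<subseteq> D" "I \<noteq> {}" "I \<noteq> D" using assms(1) by (simp_all add: separated_def)
  fix x assume x: "x \<in> I"
  show "opp x \<in> I" using x assms(1) by (simp add: separated_def)
  fix y assume y: "y \<in> I" "(p \<circ> flip A) x \<notin> I" "(p \<circ> flip A) y \<notin> I"
  have "flip A x = flip A y"
    using assms(1) x y separated_flip_in[OF assms] by (simp add: separated_def)
  then show "x = y" using flip_flip[OF assms(2)] by metis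
qed

text \<open>Edges of \<open>B\<close> avoid \<open>I\<close>, so both permutations agree on
  \<open>I\<close>. They leave \<open>I\<close> at most once, hence their cycles have the same
  traces on \<open>I\<close>.\<close>

lemma tied_separated:
  assumes p: "p permutes D" and I: "separated p I" and A: "A \<subseteq> {e \<in> E. e \<subseteq> I}"
    and B: "B \<subseteq> E - {e \<in> E. e \<subseteq> I}" and e: "e \<in> E" "e \<subseteq> I"
  shows "tied (p \<circ> flip (A \<union> B)) e \<longleftrightarrow> tied (p \<circ> flip A) e"
proof -
  have AE: "A \<subseteq> E" "A \<union> B \<subseteq> E" using A B by auto
  have "(p \<circ> flip (A \<union> B)) x = (p \<circ> flip A) x" if "x \<in> I" for x
  proof -
    have "x \<notin> \<Union>B"
    proof
      assume "x \<in> \<Union>B"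
      then obtain f where f: "f \<in> B" "x \<in> f" by blast
      then have "f = {x, opp x}" using edge_of[of f x] B by blast
      then have "f \<subseteq> I" using that I by (simp add: separated_def)
      then show False using f B by blast
    qed
    then show ?thesis by (simp add: flip_def)
  qed
  note * = orbit_Int_cong[OF comp_flip_permutes[OF p AE(2)] comp_flip_permutes[OF p AE(1)] fin _ _ this]
  have **: "orbit (p \<circ> flip (A \<union> B)) x \<inter> I = orbit (p \<circ> flip A) x \<inter> I" if "x \<in> I" for x
  proof (rule *)
    show "I \<subseteq> D" using I by (simp add: separated_def)
    show "u = v" if "u \<in> I" "v \<in> I" "(p \<circ> flip (A \<union> B)) u \<notin> I" "(p \<circ> flip (A \<union> B)) v \<notin> I" for u v
      using separated_flip[OF I AE(2)] that unfolding separated_def by blast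
  qed (use that in auto)
  show ?thesis
    unfolding tied_def
  proof (intro ball_cong refl)
    fix x y assume "x \<in> e" "y \<in> e"
    then have "x \<in> I" "y \<in> I" using e by auto
    then show "y \<in> orbit (p \<circ> flip (A \<union> B)) x \<longleftrightarrow> y \<in> orbit (p \<circ> flip A) x"
      using **[of x] by blast
  qed
qed

text \<open>Adding an edge inside \<open>I\<close> changes the number of cycles by 1 or -1, and
  which of the two happens does not depend on \<open>B\<close>.\<close>

lemma num_orbits_separated:
  assumes p: "p permutes D" and I: "separated p I" and A: "A \<subseteq> {e \<in> E. e \<subseteq> I}"
    and B: "B \<subseteq> E - {e \<in> E. e \<subseteq> I}"
  shows "num_orbits D (p \<circ> flip (A \<union> B)) + num_orbits D p
    = num_orbits D (p \<circ> flip A) + num_orbits D (p \<circ> flip B)"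
proof -
  have "finite A" using A finite_E finite_subset by fastforce
  then show ?thesis using A
  proof (induction A rule: finite_induct)
    case empty
    then show ?case by (simp add: flip_empty)
  next
    case (insert e A)
    have sub: "A \<subseteq> {e \<in> E. e \<subseteq> I}" "A \<subseteq> E" "A \<union> B \<subseteq> E" "e \<in> E" "e \<subseteq> I" "e \<notin> A" "e \<notin> A \<union> B"
      using insert B by auto
    have "num_orbits D (p \<circ> flip (insert e C)) + (if tied (p \<circ> flip C) e then 0 else 2)
        = Suc (num_orbits D (p \<circ> flip C))"
      if "C \<subseteq> E" "e \<notin> C" for C
      using num_orbits_flip[OF comp_flip_permutes[OF p that(1)] sub(4)] flip_insert(2)[OF sub(4) that]
      by (simp add: comp_assoc split: if_splits)
    note steps = this[OF sub(2,6)] this[OF sub(3,7)]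
    show ?case
      using steps insert.IH[OF sub(1)] unfolding tied_separated[OF p I sub(1) B sub(4,5)] Un_insert_left
      by linarith
  qed
qed

text \<open>The chord \<open>l\<close> divides the cycle into two sides, and each chord of
  \<open>K\<close> lies on one of them. Crossing chords lie on the same side, so by induction all of
  \<open>K\<close> does.\<close>

lemma interlaced_one_side:
  assumes p: "p permutes D" "num_orbits D p = 1" and l: "l \<in> E"
    and "interlaced p K" "l \<notin> K" "\<And>k. k \<in> K \<Longrightarrow> tied (p \<circ> flip {l}) k"
    and "x \<in> \<Union>K" "y \<in> \<Union>K"
  shows "y \<in> orbit (p \<circ> flip {l}) x"
  using assms(4-)
proof (induction arbitrary: x y rule: interlaced.induct)
  case (single a)
  then show ?case by (simp add: tied_def)
next
  case (insert K a b)
  define q where "q = p \<circ> flip {l}"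
  have q: "q permutes D" unfolding q_def by (rule comp_flip_edge_permutes[OF p(1) l])
  have K: "K \<subseteq> E" using interlaced_subset[OF insert.hyps(1)] by simp
  have b: "b \<in> E" using K insert.hyps(4) by blast
  note a = insert.hyps(2)
  have la: "l \<noteq> a" "l \<notin> K" "a \<noteq> b" "l \<noteq> b" using insert.prems(1) insert.hyps by auto
  have ta: "tied q a" "tied q b"
    unfolding q_def by (rule insert.prems(2); use insert.hyps(4) in simp)+
  have IH: "y \<in> orbit q x" if "x \<in> \<Union>K" "y \<in> \<Union>K" for x y

    unfolding q_def by (rule insert.IH[OF la(2) _ that], rule insert.prems(2)) simp
  \<comment> \<open>If the crossing chords \<open>a\<close> and \<open>b\<close> lay on different
    sides, flipping both would split each side, giving four cycles. But flipping \<open>a\<close>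
    and \<open>b\<close> first leaves one cycle, and \<open>l\<close> can then add only one
    more.\<close>
  have ab: "v \<in> orbit q u" if uv: "u \<in> a" "v \<in> b" for u v
  proof (rule ccontr)
    assume no: "v \<notin> orbit q u"
    define r where "r = q \<circ> flip {a}"
    have r: "r permutes D" unfolding r_def by (rule comp_flip_edge_permutes[OF q a])
    have bv: "b = {v, opp v}" by (rule edge_of(1)[OF b uv(2)])
    have "orbit r v = orbit q v"
    proof (rule orbit_cong[OF permutes_orbit_self[OF q fin]])
      fix w assume w: "w \<in> orbit q v"
      have "w \<notin> a"
      proof
        assume "w \<in> a"
        then have "w \<in> orbit q u" using ta(1) uv(1) by (simp add: tied_def)
        then have "orbit q u = orbit q v" using permutes_orbit_eq[OF q fin] w by metis
        then show False using no permutes_orbit_self[OF q fin, of v] by simp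
      qed
      then show "r w = q w" by (simp add: r_def flip_def)
    qed
    then have "tied r b" using ta(2) unfolding bv tied_iff[OF q] tied_iff[OF r] by simp
    then have "int (num_orbits D (r \<circ> flip {b})) = int (num_orbits D q) + 2"
      using num_orbits_flip[OF r b] num_orbits_flip[OF q a] ta(1) by (simp add: r_def)
    also have "\<dots> = 4" using num_orbits_tied(1)[OF p l] by (simp add: q_def)
    finally have four: "int (num_orbits D (r \<circ> flip {b})) = 4" .
    define s where "s = p \<circ> flip {a} \<circ> flip {b}"
    have s: "s permutes D" unfolding s_def by (intro comp_flip_edge_permutes p a b)
    have comm: "flip {l} \<circ> flip {c} = flip {c} \<circ> flip {l}" if "c \<in> E" "l \<noteq> c" for c
      using flip_insert[of l "{c}"] l that by simp
    have "r \<circ> flip {b} = p \<circ> (flip {l} \<circ> flip {a}) \<circ> flip {b}"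
      by (simp add: r_def q_def comp_assoc)
    also have "\<dots> = p \<circ> flip {a} \<circ> (flip {l} \<circ> flip {b})"
      unfolding comm[OF a la(1)] by (simp only: comp_assoc)
    also have "\<dots> = s \<circ> flip {l}"
      unfolding comm[OF b la(4)] by (simp only: comp_assoc s_def)
    finally have "int (num_orbits D (s \<circ> flip {l})) = 4" using four by simp
    moreover have "num_orbits D s = 1"
      unfolding s_def by (rule num_orbits_cross[OF p a b insert.hyps(5)])
    ultimately show False using num_orbits_flip[OF s l] by (simp split: if_splits)
  qed
  obtain v where v: "v \<in> b" using b by (auto simp: E_def)
  have key: "orbit q w = orbit q v" if "w \<in> \<Union>(insert a K)" for w
  proof (cases "w \<in> a")
    case True
    then show ?thesis using permutes_orbit_eq[OF q fin ab[OF True v]] by simp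
  next
    case False
    then have "w \<in> \<Union>K" using that by simp
    moreover have "v \<in> \<Union>K" using v insert.hyps(4) by blast
    ultimately show ?thesis using permutes_orbit_eq[OF q fin IH[of w v]] by simp
  qed
  show ?case
    using key[OF insert.prems(3)] key[OF insert.prems(4)] permutes_orbit_self[OF q fin, of y]
    by (simp add: q_def comp_def)
qed

end

text \<open>\<open>gap p S x k\<close>: the first element of \<open>S\<close> on the path \<open>x, p x, p (p x), \<dots>\<close> is \<open>k\<close>.\<close>

inductive gap :: "('a \<Rightarrow> 'a) \<Rightarrow> 'a set \<Rightarrow> 'a \<Rightarrow> 'a \<Rightarrow> bool" for p S where
  here: "k \<in> S \<Longrightarrow> gap p S k k"
| step: "x \<notin> S \<Longrightarrow> gap p S (p x) k \<Longrightarrow> gap p S x k"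

lemma gap_in: "gap p S x k \<Longrightarrow> k \<in> S"
  by (induction rule: gap.induct) auto

lemma gap_here_iff: "x \<in> S \<Longrightarrow> gap p S x k \<longleftrightarrow> k = x"
  using gap.here[of x S p] by (auto elim: gap.cases)

lemma gap_step_iff: "x \<notin> S \<Longrightarrow> gap p S x k \<longleftrightarrow> gap p S (p x) k"
  using gap.step[of x S p k] gap_in[of p S x x] by (auto elim: gap.cases)

lemma gap_unique: "gap p S x k \<Longrightarrow> gap p S x j \<Longrightarrow> j = k"
  by (induction rule: gap.induct) (simp_all add: gap_here_iff gap_step_iff)

lemma gap_exists:
  assumes "y \<in> orbit p x" "y \<in> S" shows "\<exists>k. gap p S x k"
proof -
  have "(p ^^ n) x \<in> S \<Longrightarrow> \<exists>k. gap p S x k" for n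
  proof (induction n arbitrary: x)
    case 0
    then show ?case using gap_here_iff[of x S p] by auto
  next
    case (Suc n)
    show ?case
    proof (cases "x \<in> S")
      case True
      then show ?thesis using gap_here_iff[of x S p] by auto
    next
      case False
      have "(p ^^ n) (p x) \<in> S" using Suc.prems by (simp add: funpow_swap1)
      then show ?thesis using Suc.IH[of "p x"] gap_step_iff[OF False] by auto
    qed
  qed
  moreover obtain n where "y = (p ^^ n) x" using assms(1) unfolding orbit_altdef by auto
  ultimately show ?thesis using assms(2) by simp
qed

text \<open>\<open>q\<close> is \<open>p\<close> with the successors of \<open>x\<close> and
  \<open>t\<close> exchanged. From \<open>x\<close> it continues as \<open>p\<close> does after
  \<open>t\<close> and runs into \<open>k\<close>. It cannot pass \<open>x\<close> on the way,
  because the first element of \<open>S\<close> from \<open>x\<close> is not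
  \<open>k\<close>.\<close>

lemma gap_swap:
  assumes q: "q x = p t" "q t = p x" "\<And>z. z \<noteq> x \<Longrightarrow> z \<noteq> t \<Longrightarrow> q z = p z"
    and no: "\<not> gap p S x k" and t: "t \<notin> S" "gap p S t k"
  shows "k \<in> orbit q x"
proof -
  have "gap p S y k \<Longrightarrow> k = y \<or> k \<in> orbit q y \<or> k \<in> orbit q x" for y
  proof -
    assume "gap p S y k"
    then show ?thesis using no
    proof (induction rule: gap.induct)
      case (here k)
      then show ?case by simp
    next
      case (step y k)
      then have "y \<noteq> x" using gap.step[of y S p k] by auto
      have IH: "k = p y \<or> k \<in> orbit q (p y) \<or> k \<in> orbit q x" using step by blast
      show ?case
      proof (cases "y = t")
        case True
        then show ?thesis using IH q(1) orbit.base[of q x] orbit_subset[of k q x] by auto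
      next
        case False
        then show ?thesis
          using IH q(3)[OF \<open>y \<noteq> x\<close> False] orbit.base[of q y] orbit_subset[of k q y] by auto
      qed
    qed
  qed
  from this[of "p t"] t show ?thesis
    using gap_step_iff[OF t(1), of p k] q(1) orbit.base[of q x] orbit_subset[of k q x] by auto
qed

section \<open>From a vanishing orbit sum to a separating set\<close>

context dart_pairing begin

text \<open>The ends of \<open>K\<close> cut the cycle into gaps. A chord outside \<open>K\<close>
  crosses none of \<open>K\<close>, hence has both ends in the same gap, so a nonempty gap is a
  union of edges that can be left in one place only.\<close>

lemma interval_separated:
  assumes p: "p permutes D" "num_orbits D p = 1" and K: "interlaced p K" "K \<noteq> E"
    and nc: "\<And>l k. l \<in> E \<Longrightarrow> l \<notin> K \<Longrightarrow> k \<in> K \<Longrightarrow> \<not> cross p l k"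
  shows "\<exists>I. separated p I"
proof -
  have KE: "K \<subseteq> E" "K \<noteq> {}" using interlaced_subset[OF K(1)] by auto
  define S where "S = \<Union>K"
  have SD: "S \<subseteq> D" unfolding S_def by (rule Union_subset[OF KE(1)])
  have S_edge: "{x, opp x} \<in> E - K" if "x \<in> D" "x \<notin> S" for x
    using that by (auto simp: S_def E_def)
  have S_opp: "opp x \<notin> S" if "x \<in> D" "x \<notin> S" for x
    using opp_in_Union[OF KE(1), of "opp x"] that opp_opp[OF that(1)] by (auto simp: S_def)
  obtain l0 where l0: "l0 \<in> E" "l0 \<notin> K" using K(2) KE(1) by blast
  obtain s0 where s0: "s0 \<in> l0" "s0 \<in> D" using l0(1) by (auto elim: edgeE)
  have "s0 \<notin> S"
  proof
    assume "s0 \<in> S"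
    then obtain k where "k \<in> K" "s0 \<in> k" by (auto simp: S_def)
    then show False using edges_disjoint[of l0 k] l0 KE(1) s0(1) by blast
  qed
  have "S \<noteq> {}" using KE by (force simp: S_def E_def)
  then obtain y0 where y0: "y0 \<in> S" by blast
  have y0_orbit: "y0 \<in> orbit p x" if "x \<in> D" for x
    by (rule num_orbits_1_in_orbit[OF p that]) (use y0 SD in blast)
  have gap_ex: "\<exists>k. gap p S x k" if "x \<in> D" for x
    using gap_exists[OF y0_orbit[OF that] y0] .
  obtain k0 where k0: "gap p S s0 k0" using gap_ex[OF s0(2)] by blast
  have k0S: "k0 \<in> S" by (rule gap_in[OF k0])
  define I where "I = {x \<in> D. x \<notin> S \<and> gap p S x k0}"
  \<comment> \<open>If \<open>x\<close> and \<open>opp x\<close> lay in gaps with different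
    endpoints \<open>k0\<close> and \<open>k\<close>, then flipping this chord \<open>l\<close>
    would put \<open>x\<close> on a cycle with \<open>k\<close> and \<open>opp x\<close> on a cycle
    with \<open>k0\<close>. All of \<open>K\<close> is on one cycle, so the ends of \<open>l\<close>
    would be too, although flipping \<open>l\<close> separates them.\<close>
  have opp_gap: "gap p S (opp x) k0" if x: "x \<in> I" for x
  proof (rule ccontr)
    assume no: "\<not> gap p S (opp x) k0"
    define l where "l = {x, opp x}"
    define q where "q = p \<circ> flip {l}"
    have xD: "x \<in> D" "x \<notin> S" "gap p S x k0" using x by (auto simp: I_def)
    have l: "l \<in> E" "l \<notin> K" using S_edge[OF xD(1,2)] by (auto simp: l_def)
    have oD: "opp x \<in> D" "opp x \<notin> S" using opp_in[OF xD(1)] S_opp[OF xD(1,2)] by auto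
    obtain k where k: "gap p S (opp x) k" using gap_ex[OF oD(1)] by blast
    then have "\<not> gap p S x k" using gap_unique[OF xD(3)] no by blast
    have q: "q permutes D" unfolding q_def by (rule comp_flip_edge_permutes[OF p(1) l(1)])
    have q_eq: "q x = p (opp x)" "q (opp x) = p x" "\<And>z. z \<noteq> x \<Longrightarrow> z \<noteq> opp x \<Longrightarrow> q z = p z"
      using opp_opp[OF xD(1)] by (auto simp: q_def flip_def l_def)
    have "k \<in> orbit q x"
      by (rule gap_swap[of q x p "opp x", OF q_eq \<open>\<not> gap p S x k\<close> oD(2) k])
    moreover have "k0 \<in> orbit q (opp x)"
      by (rule gap_swap[of q "opp x" p x, OF q_eq(2,1) q_eq(3) no xD(2,3)])
    moreover have "k \<in> orbit q k0"
      unfolding q_def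
    proof (rule interlaced_one_side[OF p l(1) K(1) l(2)])
      show "tied (p \<circ> flip {l}) j" if "j \<in> K" for j using nc[OF l that] by (simp add: cross_def)
      show "k0 \<in> \<Union>K" "k \<in> \<Union>K" using k0S gap_in[OF k] by (simp_all add: S_def)
    qed
    ultimately have "orbit q x = orbit q (opp x)"
      using permutes_orbit_eq[OF q fin] by metis
    then have "tied q l"
      unfolding l_def tied_iff[OF q] using permutes_orbit_self[OF q fin, of "opp x"] by simp
    then show False using num_orbits_tied(2)[OF p l(1)] by (simp add: q_def)
  qed
  have "separated p I"
    unfolding separated_def
  proof (intro conjI ballI impI)
    show "I \<subseteq> D" by (auto simp: I_def)
    have "s0 \<in> I" using s0 k0 \<open>s0 \<notin> S\<close> by (simp add: I_def)
    then show "I \<noteq> {}" by blast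
    have "y0 \<notin> I" "y0 \<in> D" using y0 SD by (auto simp: I_def)
    then show "I \<noteq> D" by blast
    fix x assume x: "x \<in> I"
    then show "opp x \<in> I" using opp_gap[OF x] S_opp[of x] opp_in[of x] by (simp add: I_def)
    fix y assume y: "y \<in> I" and out: "p x \<notin> I" "p y \<notin> I"
    have "p w = k0" if "w \<in> I" "p w \<notin> I" for w
    proof -
      have w: "w \<in> D" "w \<notin> S" "gap p S (p w) k0" using that gap_step_iff[of w S p k0] by (auto simp: I_def)
      moreover have "p w \<in> D" using w permutes_in_image[OF p(1)] by simp
      ultimately have "p w \<in> S" using that(2) by (auto simp: I_def)
      then show ?thesis using gap_here_iff[of "p w" S p k0] w by simp
    qed
    from this[OF x out(1)] this[OF y out(2)] have "p x = p y" by (rule trans[OF _ sym])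
    then show "x = y" using inj_eq[OF permutes_inj[OF p(1)]] by simp
  qed
  then show ?thesis by blast
qed

text \<open>A maximal interlaced set is not all of \<open>E\<close>, since the sum would then be
  positive, and by maximality no further chord crosses it.\<close>

lemma orbit_sum_0_imp_separated:
  assumes p: "p permutes D" "num_orbits D p = 1" and "D \<noteq> {}" "orbit_sum p E = 0"
  shows "\<exists>I. separated p I"
proof -
  obtain e where e: "e \<in> E" using assms(3) by (auto simp: E_def)
  define C where "C = {K. interlaced p K}"
  have "C \<subseteq> Pow E" using interlaced_subset by (auto simp: C_def)
  then have "finite C" using finite_E finite_subset by auto
  moreover have "{e} \<in> C" using e by (simp add: C_def interlaced.single)
  ultimately obtain K where K: "K \<in> C" "\<And>L. L \<in> C \<Longrightarrow> K \<subseteq> L \<Longrightarrow> K = L"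
    using finite_has_maximal[of C] by blast
  have inter: "interlaced p K" using K(1) by (simp add: C_def)
  have "K \<noteq> E" using orbit_sum_pos[OF inter p] assms(4) by auto
  moreover have "\<not> cross p l k" if "l \<in> E" "l \<notin> K" "k \<in> K" for l k
    using interlaced.insert[OF inter that] K(2)[of "insert l K"] that(2) by (auto simp: C_def)
  ultimately show ?thesis using interval_separated[OF p inter] by blast
qed

lemma orbit_sum_flip_set:
  assumes "A \<subseteq> F" "F \<subseteq> E"
  shows "orbit_sum (p \<circ> flip A) F = (- 1) ^ card A * orbit_sum p F"
proof -
  have "finite A" using assms finite_E finite_subset by (metis order_trans)
  then show ?thesis using assms(1)
  proof (induction A rule: finite_induct)
    case empty
    then show ?case by (simp add: flip_empty)
  next
    case (insert a A)
    have a: "a \<in> F" "a \<in> E" "A \<subseteq> E" "A \<subseteq> F" using insert assms(2) by auto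
    have eq: "p \<circ> flip (insert a A) = p \<circ> flip A \<circ> flip {a}"
      unfolding flip_insert(2)[OF a(2,3) insert.hyps(2)] by (simp only: comp_assoc)
    show ?case
      unfolding eq orbit_sum_flip[OF a(1) assms(2)] insert.IH[OF a(4)] using insert.hyps by simp
  qed
qed

text \<open>Choose the flips with the fewest cycles. No further flip merges two, so every edge has
  both ends on one cycle. Such a cycle is closed under \<open>p\<close> and \<open>opp\<close>,
  hence is everything.\<close>

lemma exists_num_orbits_1:
  assumes p: "p permutes D" and "D \<noteq> {}"
    and conn: "\<And>U. U \<subseteq> D \<Longrightarrow> U \<noteq> {} \<Longrightarrow> (\<And>x. x \<in> U \<Longrightarrow> p x \<in> U \<and> opp x \<in> U) \<Longrightarrow> U = D"
  shows "\<exists>A\<subseteq>E. num_orbits D (p \<circ> flip A) = 1"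
proof -
  obtain A where A: "A \<subseteq> E" "\<And>B. B \<subseteq> E \<Longrightarrow> num_orbits D (p \<circ> flip A) \<le> num_orbits D (p \<circ> flip B)"
    using ex_has_least_nat[of "\<lambda>A. A \<subseteq> E" "{}" "\<lambda>A. num_orbits D (p \<circ> flip A)"] by auto
  define q where "q = p \<circ> flip A"
  have q: "q permutes D" unfolding q_def by (rule comp_flip_permutes[OF p A(1)])
  have tied: "tied q e" if e: "e \<in> E" for e
  proof (rule ccontr)
    assume "\<not> tied q e"
    then have less: "num_orbits D (q \<circ> flip {e}) < num_orbits D q"
      using num_orbits_flip[OF q e] by simp
    have "\<exists>B\<subseteq>E. q \<circ> flip {e} = p \<circ> flip B"
    proof (cases "e \<in> A")
      case True
      define B where "B = A - {e}"
      have B: "A = insert e B" "B \<subseteq> E" "e \<notin> B" using True A(1) by (auto simp: B_def)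
      have "q \<circ> flip {e} = p \<circ> flip B \<circ> flip {e} \<circ> flip {e}"
        unfolding q_def B(1) flip_insert(2)[OF e B(2,3)] by (simp only: comp_assoc)
      then show ?thesis using B(2) flip_edge_twice[OF e, of "p \<circ> flip B"] by metis
    next
      case False
      then have "q \<circ> flip {e} = p \<circ> flip (insert e A)"
        unfolding q_def flip_insert(2)[OF e A(1) False] by (simp only: comp_assoc)
      then show ?thesis using e A(1) by (intro exI[of _ "insert e A"]) simp
    qed
    then show False using A(2) less by (metis q_def not_le)
  qed
  obtain d where d: "d \<in> D" using assms(2) by blast
  have opp_orbit: "opp x \<in> orbit q d" if "x \<in> orbit q d" "x \<in> D" for x
  proof -
    have "{x, opp x} \<in> E" using that(2) by (auto simp: E_def)
    then have "opp x \<in> orbit q x" using tied tied_iff[OF q] by blast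
    then show ?thesis using permutes_orbit_eq[OF q fin that(1)] by simp
  qed
  have "orbit q d = D"
  proof (rule conn)
    show sub: "orbit q d \<subseteq> D" by (rule permutes_orbit_subset[OF q d])
    show "orbit q d \<noteq> {}" by (rule orbit_nonempty)
    fix x assume x: "x \<in> orbit q d"
    then have xD: "x \<in> D" using sub by blast
    have "flip A x \<in> orbit q d" using x opp_orbit[OF x xD] by (simp add: flip_def)
    then have "q (flip A x) \<in> orbit q d" by (rule orbit.step)
    moreover have "q (flip A x) = p x" by (simp add: q_def flip_flip[OF A(1)])
    ultimately show "p x \<in> orbit q d \<and> opp x \<in> orbit q d" using opp_orbit[OF x xD] by simp
  qed
  then have "orbit q x = D" if "x \<in> D" for x using permutes_orbit_eq[OF q fin, of x d] that by simp
  then have "orbit q ` D = {D}" using d by auto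
  then show ?thesis using A(1) by (auto simp: num_orbits_def q_def)
qed

text \<open>Suitable flips turn \<open>p\<close> into a single cycle. They change the sum only by a
  sign, and flipping back keeps a separating set separating.\<close>

theorem connected_orbit_sum_0_imp_separated:
  assumes p: "p permutes D" and "D \<noteq> {}"
    and "\<And>U. U \<subseteq> D \<Longrightarrow> U \<noteq> {} \<Longrightarrow> (\<And>x. x \<in> U \<Longrightarrow> p x \<in> U \<and> opp x \<in> U) \<Longrightarrow> U = D"
    and "orbit_sum p E = 0"
  shows "\<exists>I. separated p I"
proof -
  obtain A where A: "A \<subseteq> E" "num_orbits D (p \<circ> flip A) = 1"
    using exists_num_orbits_1[OF assms(1-3)] by blast
  have q: "p \<circ> flip A permutes D" by (rule comp_flip_permutes[OF p A(1)])
  have "orbit_sum (p \<circ> flip A) E = 0" using orbit_sum_flip_set[OF A(1)] assms(4) by simp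
  then obtain I where "separated (p \<circ> flip A) I"
    using orbit_sum_0_imp_separated[OF q A(2) assms(2)] by blast
  then have "separated (p \<circ> flip A \<circ> flip A) I" by (rule separated_flip[OF _ A(1)])
  moreover have "p \<circ> flip A \<circ> flip A = p" using flip_flip[OF A(1)] by (simp add: fun_eq_iff)
  ultimately show ?thesis by metis
qed

text \<open>The value of \<open>sigma\<close> when \<open>p\<close> is the rotation of a ribbon
  graph. By \<open>dart_rank_twice\<close>, neither \<open>div\<close> nor \<open>nat\<close> loses
  anything on subsets of \<open>E\<close>.\<close>

definition dart_rank :: "('d \<Rightarrow> 'd) \<Rightarrow> 'd set set \<Rightarrow> nat" where
  "dart_rank p A = nat ((int (card A) + int (num_orbits D p) - int (num_orbits D (p \<circ> flip A))) div 2)"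

text \<open>Adding an edge raises the cardinality by 1 and changes the number of cycles by 1 or -1,
  so the numerator grows by 0 if the ends are on one cycle and by 2 otherwise. Evenness,
  nonnegativity and the bounds on the increment all follow.\<close>

lemma
  assumes p: "p permutes D"
  shows dart_rank_empty: "dart_rank p {} = 0"
    and dart_rank_twice: "A \<subseteq> E \<Longrightarrow> 2 * int (dart_rank p A)
      = int (card A) + int (num_orbits D p) - int (num_orbits D (p \<circ> flip A))"
    and dart_rank_insert: "A \<subseteq> E \<Longrightarrow> e \<in> E \<Longrightarrow> e \<notin> A \<Longrightarrow>
      dart_rank p A \<le> dart_rank p (insert e A) \<and> dart_rank p (insert e A) \<le> Suc (dart_rank p A)"
proof -
  show "dart_rank p {} = 0" by (simp add: dart_rank_def flip_empty)
  have step: "int (num_orbits D (p \<circ> flip (insert e A)))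
      = int (num_orbits D (p \<circ> flip A)) + (if tied (p \<circ> flip A) e then 1 else - 1)"
    if "A \<subseteq> E" "e \<in> E" "e \<notin> A" for e A
    using num_orbits_flip[OF comp_flip_permutes[OF p that(1)] that(2)] flip_insert(2)[OF that(2,1,3)]
    by (simp only: comp_assoc)
  have fin': "finite A" if "A \<subseteq> E" for A using that finite_E finite_subset by blast
  have ex: "\<exists>n. 2 * int n = int (card A) + int (num_orbits D p) - int (num_orbits D (p \<circ> flip A))"
    if "A \<subseteq> E" for A
    using fin'[OF that] that
  proof (induction A rule: finite_induct)
    case empty
    then show ?case by (simp add: flip_empty)
  next
    case (insert e A)
    then have "A \<subseteq> E" by blast
    from insert.IH[OF this] obtain n
      where n: "2 * int n = int (card A) + int (num_orbits D p) - int (num_orbits D (p \<circ> flip A))"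
      by (elim exE) (simp add: comp_def)
    have "card (insert e A) = Suc (card A)" using insert.hyps by simp
    then have "2 * int (if tied (p \<circ> flip A) e then n else Suc n)
        = int (card (insert e A)) + int (num_orbits D p) - int (num_orbits D (p \<circ> flip (insert e A)))"
      using n step[of A e] insert.hyps insert.prems by (cases "tied (p \<circ> flip A) e") simp_all
    then show ?case by blast
  qed
  show twice: "2 * int (dart_rank p A)
      = int (card A) + int (num_orbits D p) - int (num_orbits D (p \<circ> flip A))" if "A \<subseteq> E" for A
  proof -
    obtain n where n: "2 * int n = int (card A) + int (num_orbits D p) - int (num_orbits D (p \<circ> flip A))"
      using ex[OF \<open>A \<subseteq> E\<close>] by blast
    then have "dart_rank p A = n" unfolding dart_rank_def n[symmetric] by simp
    then show ?thesis using n by simp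
  qed
  assume A: "A \<subseteq> E" "e \<in> E" "e \<notin> A"
  have "card (insert e A) = Suc (card A)" using A fin' by simp
  then show "dart_rank p A \<le> dart_rank p (insert e A) \<and> dart_rank p (insert e A) \<le> Suc (dart_rank p A)"
    using twice[of A] twice[of "insert e A"] A step[OF A] by (cases "tied (p \<circ> flip A) e") simp_all
qed

lemma dart_rank_mono:
  assumes p: "p permutes D" and "A \<subseteq> B" "B \<subseteq> E"
  shows "dart_rank p A \<le> dart_rank p B \<and> dart_rank p B + card A \<le> dart_rank p A + card B"
proof -
  have "finite (B - A)" using finite_subset[OF assms(3) finite_E] by simp
  then have "A \<union> (B - A) \<subseteq> E \<Longrightarrow> A \<inter> (B - A) = {} \<Longrightarrow>
    dart_rank p A \<le> dart_rank p (A \<union> (B - A)) \<and>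
    dart_rank p (A \<union> (B - A)) + card A \<le> dart_rank p A + card (A \<union> (B - A))"
  proof (induction rule: finite_induct)
    case empty
    then show ?case by simp
  next
    case (insert e F)
    have sub: "A \<union> F \<subseteq> E" "e \<in> E" "e \<notin> A \<union> F" "A \<inter> F = {}" using insert by auto
    have "card (insert e (A \<union> F)) = Suc (card (A \<union> F))"
      using sub(3) finite_subset[OF sub(1) finite_E] by simp
    moreover have "dart_rank p A \<le> dart_rank p (A \<union> F) \<and>
        dart_rank p (A \<union> F) + card A \<le> dart_rank p A + card (A \<union> F)"
      by (rule insert.IH[OF sub(1,4)])
    ultimately show ?case
      using dart_rank_insert[OF p sub(1,2,3)] unfolding Un_insert_right by linarith
  qed
  moreover have "A \<union> (B - A) = B" using assms(2) by blast
  ultimately show ?thesis using assms(2,3) by simp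
qed

lemma dart_rank_separated:
  assumes p: "p permutes D" and I: "separated p I" and A: "A \<subseteq> {e \<in> E. e \<subseteq> I}"
    and B: "B \<subseteq> E - {e \<in> E. e \<subseteq> I}"
  shows "dart_rank p (A \<union> B) = dart_rank p A + dart_rank p B"
proof -
  have AB: "A \<subseteq> E" "B \<subseteq> E" "A \<union> B \<subseteq> E" "A \<inter> B = {}" using A B by blast+
  then have "finite A" "finite B" using finite_E finite_subset by auto
  then have "card (A \<union> B) = card A + card B" using AB(4) card_Un_disjoint by blast
  then show ?thesis
    using num_orbits_separated[OF assms] dart_rank_twice[OF p AB(1)] dart_rank_twice[OF p AB(2)]
      dart_rank_twice[OF p AB(3)] by linarith
qed

text \<open>Of the three terms in \<open>dart_rank_twice\<close>, the cardinality and the constant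
  drop out of the alternating sum; for the cardinality this takes two edges.\<close>

lemma sum_dart_rank:
  assumes p: "p permutes D" and "card E \<ge> 2"
  shows "2 * (\<Sum>A\<in>Pow E. (- 1) ^ card A * int (dart_rank p A)) = orbit_sum p E"
proof -
  \<comment> \<open>Pairing \<open>A\<close> with \<open>insert e A\<close> cancels the
    cardinalities and leaves an alternating sum of signs over the subsets of the nonempty set
    \<open>F\<close>.\<close>
  have alt: "(\<Sum>A\<in>Pow E. (- 1) ^ card A * int (card A)) = 0"
  proof -
    obtain e where e: "e \<in> E" using assms(2) by fastforce
    define F where "F = E - {e}"
    have F: "E = insert e F" "e \<notin> F" "finite F" using e finite_E by (auto simp: F_def)
    then have "F \<noteq> {}" using assms(2) by auto
    have "(- 1) ^ card (insert e A) * int (card (insert e A))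
        = - ((- 1) ^ card A * int (card A)) - (- 1) ^ card A" if "A \<in> Pow F" for A
    proof -
      have "finite A" "e \<notin> A" using that F finite_subset[of A F] by auto
      then show ?thesis by (simp add: algebra_simps)
    qed
    then show ?thesis
      unfolding F(1) sum_Pow_insert[OF F(3,2)]
      using sum_minus_one_power_card_Pow[OF F(3) \<open>F \<noteq> {}\<close>, where ?'a = int]
      by (simp add: sum_subtractf sum_negf)
  qed
  have "E \<noteq> {}" using assms(2) by auto
  have "2 * (\<Sum>A\<in>Pow E. (- 1) ^ card A * int (dart_rank p A))
    = (\<Sum>A\<in>Pow E. (- 1) ^ card A * (2 * int (dart_rank p A)))"
    by (simp add: sum_distrib_left algebra_simps)
  also have "\<dots> = (\<Sum>A\<in>Pow E. (- 1) ^ card A * int (card A) + int (num_orbits D p) * (- 1) ^ card A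
      - (- 1) ^ card A * int (num_orbits D (p \<circ> flip A)))"
    by (rule sum.cong[OF refl]) (simp add: dart_rank_twice[OF p] algebra_simps)
  also have "\<dots> = orbit_sum p E"
    using alt sum_minus_one_power_card_Pow[OF finite_E \<open>E \<noteq> {}\<close>, where ?'a = int]
    by (simp add: sum_subtractf sum.distrib orbit_sum_def flip: sum_distrib_left)
  finally show ?thesis .
qed

end

section \<open>Factorizations of bivariate polynomials\<close>

text \<open>The homogenization of \<open>p\<close> in degree \<open>m\<close> at
  \<open>(a, b)\<close>: if \<open>degree p \<le> m\<close>, it stands for \<open>b ^ m\<close>
  times the value of \<open>p\<close> at the quotient of \<open>a\<close> by \<open>b\<close>,
  without dividing.\<close>

definition homog :: "nat \<Rightarrow> 'a :: comm_ring_1 poly \<Rightarrow> 'a \<Rightarrow> 'a \<Rightarrow> 'a" where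
  "homog m p a b = (\<Sum>j\<le>m. coeff p j * a ^ j * b ^ (m - j))"

lemma homog_0: "homog 0 p a b = coeff p 0"
  by (simp add: homog_def)

lemma homog_add: "homog m (p + q) a b = homog m p a b + homog m q a b"
  by (simp add: homog_def algebra_simps sum.distrib)

lemma homog_sum: "homog m (sum f A) a b = (\<Sum>x\<in>A. homog m (f x) a b)"
  unfolding homog_def coeff_sum sum_distrib_right by (rule sum.swap)

lemma homog_smult: "homog m (smult c p) a b = c * homog m p a b"
  by (simp add: homog_def sum_distrib_left algebra_simps)

lemma homog_pCons: "homog (Suc m) (pCons c p) a b = c * b ^ Suc m + a * homog m p a b"
  unfolding homog_def sum.atMost_Suc_shift by (simp add: sum_distrib_left algebra_simps)

lemma homog_raise:
  assumes "degree p \<le> m" shows "homog (m + k) p a b = b ^ k * homog m p a b"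
proof (induction k)
  case (Suc k)
  have "homog (Suc (m + k)) p a b = (\<Sum>j\<le>m + k. b * (coeff p j * a ^ j * b ^ (m + k - j)))"
    unfolding homog_def sum.atMost_Suc using assms
    by (simp add: coeff_eq_0 Suc_diff_le mult.left_commute)
  also have "\<dots> = b * homog (m + k) p a b"
    unfolding homog_def sum_distrib_left ..
  finally show ?case using Suc by simp
qed simp

lemma homog_mult:
  assumes "degree p \<le> m" "degree q \<le> n"
  shows "homog (m + n) (p * q) a b = homog m p a b * homog n q a b"
  using assms(1)
proof (induction p arbitrary: m)
  case 0
  then show ?case by (simp add: homog_def)
next
  case (pCons c p)
  show ?case
  proof (cases "p = 0")
    case True
    have "homog (n + m) (smult c q) a b = c * (b ^ m * homog n q a b)"
      using homog_raise[OF assms(2), of m a b] by (simp add: homog_smult)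
    moreover have "homog m [:c:] a b = b ^ m * c"
      using homog_raise[of "[:c:]" 0 m a b] by (simp add: homog_0)
    ultimately show ?thesis using True by (simp add: algebra_simps)
  next
    case False
    then obtain m' where m': "m = Suc m'" "degree p \<le> m'" using pCons.prems by (cases m) auto
    have "homog (n + m) (smult c q) a b = c * (b ^ m * homog n q a b)"
      using homog_raise[OF assms(2), of m a b] by (simp add: homog_smult)
    moreover have "homog (m + n) (pCons 0 (p * q)) a b = a * homog (m' + n) (p * q) a b"
      unfolding m' add_Suc homog_pCons by simp
    ultimately show ?thesis
      unfolding mult_pCons_left homog_add using pCons.IH[OF m'(2)] homog_pCons[of m' c p a b] m'(1)
      by (simp add: algebra_simps)
  qed
qed

text \<open>The outer variable is \<open>y\<close>, so the degree in \<open>x\<close> is found among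
  the coefficients. The index set is never empty, so the maximum makes sense for
  \<open>p = 0\<close> too.\<close>

definition x_degree :: "'a :: zero poly poly \<Rightarrow> nat" where
  "x_degree p = Max ((\<lambda>j. degree (coeff p j)) ` {..degree p})"

lemma degree_coeff_le_x_degree: "degree (coeff p j) \<le> x_degree p"
proof (cases "j \<le> degree p")
  case True
  then show ?thesis unfolding x_degree_def by (intro Max_ge) auto
next
  case False
  then show ?thesis by (simp add: coeff_eq_0)
qed

lemma x_degree_le: assumes "\<And>j. degree (coeff p j) \<le> d" shows "x_degree p \<le> d"
  unfolding x_degree_def using assms by (intro Max.boundedI) auto

lemma x_degree_attained:
  assumes "p \<noteq> 0" shows "\<exists>j. coeff (coeff p j) (x_degree p) \<noteq> 0"
proof -
  have "x_degree p \<in> (\<lambda>j. degree (coeff p j)) ` {..degree p}"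
    unfolding x_degree_def by (intro Max_in) auto
  then obtain j where j: "x_degree p = degree (coeff p j)" by blast
  show ?thesis
  proof (cases "coeff p j = 0")
    case True
    then have "degree (lead_coeff p) = 0" using degree_coeff_le_x_degree[of p "degree p"] j by simp
    moreover have "lead_coeff p \<noteq> 0" using assms by simp
    ultimately have "coeff (lead_coeff p) (x_degree p) \<noteq> 0"
      using True j leading_coeff_neq_0[of "lead_coeff p"] by simp
    then show ?thesis by blast
  next
    case False
    then show ?thesis unfolding j using leading_coeff_neq_0 by blast
  qed
qed

lemma coeff_mult_degree_bounds:
  fixes p q :: "'a :: comm_ring_1 poly"
  assumes "degree p \<le> m" "degree q \<le> n"
  shows "coeff (p * q) (m + n) = coeff p m * coeff q n"
proof (cases "degree p = m \<and> degree q = n")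
  case True
  then show ?thesis using coeff_mult_degree_sum[of p q] by simp
next
  case False
  then have *: "degree p < m \<or> degree q < n" using assms by auto
  then have "coeff p m * coeff q n = 0" by (auto simp: coeff_eq_0)
  moreover have "degree (p * q) < m + n" using degree_mult_le[of p q] * assms by linarith
  ultimately show ?thesis by (simp add: coeff_eq_0)
qed

text \<open>Order monomials by the power of \<open>x\<close>, then by the power of \<open>y\<close>:
  in a domain the product of the two leading terms survives. \<open>last r\<close> is the highest
  power of \<open>y\<close> occurring with the top power of \<open>x\<close>.\<close>

lemma x_degree_mult:
  fixes p q :: "'a :: idom poly poly"
  assumes "p \<noteq> 0" "q \<noteq> 0"
  shows "x_degree p + x_degree q \<le> x_degree (p * q)"
proof -
  define last where "last r = Max {j. coeff (coeff r j) (x_degree r) \<noteq> 0}" for r :: "'a poly poly"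
  have last: "coeff (coeff r (last r)) (x_degree r) \<noteq> 0"
    "\<And>j. last r < j \<Longrightarrow> coeff (coeff r j) (x_degree r) = 0" if "r \<noteq> 0" for r
  proof -
    let ?J = "{j. coeff (coeff r j) (x_degree r) \<noteq> 0}"
    have "?J \<subseteq> {..degree r}" using coeff_eq_0[of r] by (force simp: not_le[symmetric])
    then have fin: "finite ?J" using finite_subset by blast
    have "?J \<noteq> {}" using x_degree_attained[OF that] by simp
    then have "last r \<in> ?J" unfolding last_def by (rule Max_in[OF fin])
    then show "coeff (coeff r (last r)) (x_degree r) \<noteq> 0" by simp
    show "coeff (coeff r j) (x_degree r) = 0" if "last r < j" for j
    proof (rule ccontr)
      assume "coeff (coeff r j) (x_degree r) \<noteq> 0"
      then have "j \<le> last r" unfolding last_def using fin by (intro Max_ge) simp_all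
      then show False using that by simp
    qed
  qed
  let ?i = "last p" and ?j = "last q"
  have "coeff (coeff (p * q) (?i + ?j)) (x_degree p + x_degree q)
    = (\<Sum>i\<le>?i + ?j. coeff (coeff p i) (x_degree p) * coeff (coeff q (?i + ?j - i)) (x_degree q))"
    unfolding coeff_mult[of p q] coeff_sum
    by (intro sum.cong refl coeff_mult_degree_bounds degree_coeff_le_x_degree)
  also have "\<dots> = (\<Sum>i\<in>{?i}. coeff (coeff p i) (x_degree p) * coeff (coeff q (?i + ?j - i)) (x_degree q))"
  proof (rule sum.mono_neutral_right)
    show "\<forall>i\<in>{..?i + ?j} - {?i}. coeff (coeff p i) (x_degree p) * coeff (coeff q (?i + ?j - i)) (x_degree q) = 0"
    proof
      fix i assume "i \<in> {..?i + ?j} - {?i}"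
      then have "?i < i \<or> ?j < ?i + ?j - i" by auto
      then show "coeff (coeff p i) (x_degree p) * coeff (coeff q (?i + ?j - i)) (x_degree q) = 0"
        using last(2)[OF assms(1)] last(2)[OF assms(2)] by auto
    qed
  qed auto
  also have "\<dots> \<noteq> 0" using last(1)[OF assms(1)] last(1)[OF assms(2)] by simp
  finally have "x_degree p + x_degree q \<le> degree (coeff (p * q) (?i + ?j))" by (rule le_degree)
  also have "\<dots> \<le> x_degree (p * q)" by (rule degree_coeff_le_x_degree)
  finally show ?thesis .
qed

text \<open>
  Up to a power of \<open>x - 1\<close>, \<open>hyperbola m p\<close> is the restriction of \<open>p\<close> to the curve
  \<open>(x - 1) (y - 1) = 1\<close>, that is \<open>y = x / (x - 1)\<close>.
\<close>

definition hyperbola :: "nat \<Rightarrow> 'a :: comm_ring_1 poly poly \<Rightarrow> 'a poly" where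
  "hyperbola m p = homog m p [:0, 1:] [:- 1, 1:]"

lemma degree_hyperbola:
  fixes p :: "'a :: idom poly poly" shows "degree (hyperbola m p) \<le> x_degree p + m"
  unfolding hyperbola_def homog_def
proof (rule degree_sum_le)
  fix j assume "j \<in> {..m}"
  have "degree (coeff p j * [:0, 1:] ^ j * [:- 1, 1:] ^ (m - j))
      \<le> degree (coeff p j) + degree ([:0, 1 :: 'a:] ^ j) + degree ([:- 1, 1 :: 'a:] ^ (m - j))"
    by (intro order_trans[OF degree_mult_le] add_mono degree_mult_le order_refl)
  also have "\<dots> \<le> x_degree p + m"
    using degree_coeff_le_x_degree[of p j] \<open>j \<in> {..m}\<close> by (simp add: degree_power_eq)
  finally show "degree (coeff p j * [:0, 1:] ^ j * [:- 1, 1:] ^ (m - j)) \<le> x_degree p + m" .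
qed simp

lemma poly_hyperbola_0:
  fixes p :: "'a :: idom poly poly"
  shows "poly (hyperbola m p) 0 = coeff (coeff p 0) 0 * (- 1) ^ m"
proof -
  have "poly (hyperbola m p) 0 = (\<Sum>j\<le>m. if j = 0 then coeff (coeff p 0) 0 * (- 1) ^ m else 0)"
    unfolding hyperbola_def homog_def poly_sum
    by (rule sum.cong) (auto simp: poly_0_coeff_0[symmetric])
  then show ?thesis by simp
qed

text \<open>The first factor is nonzero at 0, so the second takes the whole order \<open>n\<close>.
  Then \<open>n \<le> x_degree q + l\<close>, and \<open>deg\<close> forces
  \<open>x_degree p = 0\<close> and \<open>k = 0\<close>: \<open>p\<close> is constant.\<close>

lemma hyperbola_factor_unit:
  fixes p q :: "'a :: idom poly poly"
  assumes prod: "hyperbola k p * hyperbola l q = [:0, 1:] ^ n" and k: "degree p \<le> k"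
    and deg: "x_degree p + x_degree q + (k + l) \<le> n" and nz: "poly (hyperbola k p) 0 \<noteq> 0"
  shows "p dvd 1"
proof -
  have "hyperbola k p * hyperbola l q \<noteq> 0" unfolding prod by simp
  then have q0: "hyperbola l q \<noteq> 0" by auto
  have "order 0 ([:0, 1 :: 'a:] ^ n) = n" using order_power_n_n[of "0 :: 'a" n] by simp
  then have "order 0 (hyperbola k p) + order 0 (hyperbola l q) = n"
    using order_mult[OF \<open>hyperbola k p * hyperbola l q \<noteq> 0\<close>, of 0] prod by simp
  then have "n = order 0 (hyperbola l q)" using order_0I[OF nz] by simp
  also have "\<dots> \<le> degree (hyperbola l q)" by (rule order_degree[OF q0])
  also have "\<dots> \<le> x_degree q + l" by (rule degree_hyperbola)
  finally have 0: "x_degree p = 0" "k = 0" using deg by auto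
  then have "degree p = 0" "degree (coeff p 0) = 0"
    using k degree_coeff_le_x_degree[of p 0] by simp_all
  then obtain c where c: "p = [:[:c:]:]" by (metis degree_0_id degree_eq_zeroE coeff_pCons_0)
  \<comment> \<open>Being a nonzero constant is not enough over the integers; comparing the
    coefficients of \<open>x ^ n\<close> exhibits an inverse of \<open>c\<close>.\<close>
  have "smult c (hyperbola l q) = [:0, 1:] ^ n"
    using prod by (simp add: c 0 hyperbola_def homog_0)
  then have "c * coeff (hyperbola l q) n = coeff ([:0, 1:] ^ n) n" by (metis coeff_smult)
  also have "[:0, 1 :: 'a:] ^ n = monom 1 n" by (simp add: monom_altdef)
  finally have "c * coeff (hyperbola l q) n = 1" by simp
  then have "1 = p * [:[:coeff (hyperbola l q) n:]:]" by (simp add: c one_pCons)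
  then show ?thesis by (rule dvdI)
qed

theorem no_nontrivial_factorization_hyperbola:
  fixes r :: "'a :: idom poly poly"
  assumes hyp: "hyperbola m r = [:0, 1:] ^ n" and m: "degree r \<le> m"
    and deg: "x_degree r + m \<le> n" and beta: "n \<ge> 2 \<Longrightarrow> coeff (coeff r 0) 1 \<noteq> 0"
  shows "no_nontrivial_factorization r"
  unfolding no_nontrivial_factorization_def
proof (intro allI impI)
  fix p q assume r: "r = p * q"
  have "r \<noteq> 0"
  proof
    assume "r = 0"
    then have "[:0, 1 :: 'a:] ^ n = 0" using hyp by (simp add: hyperbola_def homog_def)
    then show False by simp
  qed
  then have nz: "p \<noteq> 0" "q \<noteq> 0" using r by auto
  define k where "k = degree p"
  \<comment> \<open>\<open>l\<close> is what remains of \<open>m\<close> rather than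
    \<open>degree q\<close>, because \<open>m\<close> may exceed the degree of
    \<open>r\<close>.\<close>
  define l where "l = m - k"
  have "degree p + degree q \<le> m" using m degree_mult_eq[OF nz] r by simp
  then have kl: "degree p \<le> k" "degree q \<le> l" "m = k + l" by (auto simp: k_def l_def)
  have prod: "hyperbola k p * hyperbola l q = [:0, 1:] ^ n"
    using homog_mult[OF kl(1,2)] hyp unfolding r kl(3) hyperbola_def by simp
  have xd: "x_degree p + x_degree q + (k + l) \<le> n"
    using x_degree_mult[OF nz] deg kl(3) r by simp
  show "p dvd 1 \<or> q dvd 1"
  proof (cases "poly (hyperbola k p) 0 = 0 \<and> poly (hyperbola l q) 0 = 0")
    case False
    then show ?thesis
      using hyperbola_factor_unit[OF prod kl(1) xd] hyperbola_factor_unit[of l q k p n] prod kl(2) xd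
      by (auto simp: mult.commute add_ac)
  next
    case True
    \<comment> \<open>Both factors contribute to the order at 0, so \<open>n \<ge> 2\<close> and
      \<open>beta\<close> applies. But both constant terms vanish, so the product has no linear term
      in \<open>x\<close>.\<close>
    have "hyperbola k p * hyperbola l q \<noteq> 0" unfolding prod by simp
    then have "order 0 (hyperbola k p) \<noteq> 0" "order 0 (hyperbola l q) \<noteq> 0"
      using True by (auto simp: order_root)
    moreover have "order 0 ([:0, 1 :: 'a:] ^ n) = n" using order_power_n_n[of "0 :: 'a" n] by simp
    ultimately have "n \<ge> 2"
      using order_mult[OF \<open>hyperbola k p * hyperbola l q \<noteq> 0\<close>, of 0] prod by simp
    moreover have "coeff (coeff p 0) 0 = 0" "coeff (coeff q 0) 0 = 0"
      using True by (simp_all add: poly_hyperbola_0)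
    then have "coeff (coeff r 0) 1 = 0" by (simp add: r coeff_mult)
    ultimately show ?thesis using beta by simp
  qed
qed

section \<open>Rank generating polynomials\<close>

definition rank_poly :: "'e set \<Rightarrow> ('e set \<Rightarrow> nat) \<Rightarrow> 'a :: comm_ring_1 poly poly" where
  "rank_poly E s = (\<Sum>A\<in>Pow E. (var_x - 1) ^ (s E - s A) * (var_y - 1) ^ (card A - s A))"

lemma var_x_minus_1: "var_x - 1 = [:[:- 1, 1:] :: 'a :: comm_ring_1 poly:]"
  by (simp add: var_x_def one_pCons)

lemma var_y_minus_1: "var_y - 1 = [:- 1, 1 :: 'a :: comm_ring_1 poly:]"
  by (simp add: var_y_def one_pCons)

lemma var_x_power: "(var_x - 1) ^ i = [:[:- 1, 1 :: 'a :: comm_ring_1:] ^ i:]"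
  unfolding var_x_minus_1 by (rule poly_const_pow)

lemma coeff_linear_power:
  "coeff ([:- 1, 1 :: 'a :: comm_ring_1:] ^ i) 0 = (- 1) ^ i"
  "coeff ([:- 1, 1 :: 'a:] ^ i) (Suc 0) = - ((- 1) ^ i * of_nat i)"
proof -
  show 0: "coeff ([:- 1, 1 :: 'a:] ^ i) 0 = (- 1) ^ i" for i
    by (induction i) (simp_all add: coeff_mult_0)
  show "coeff ([:- 1, 1 :: 'a:] ^ i) (Suc 0) = - ((- 1) ^ i * of_nat i)"
    by (induction i) (simp_all add: 0 algebra_simps)
qed

lemma degree_linear_power_le: "degree ([:- 1, 1 :: 'a :: comm_ring_1:] ^ j) \<le> j"
proof -
  have "degree ([:- 1, 1 :: 'a:] ^ j) \<le> degree [:- 1, 1 :: 'a:] * j" by (rule degree_power_le)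
  also have "\<dots> \<le> j" by simp
  finally show ?thesis .
qed

text \<open>On the curve \<open>y - 1\<close> is the inverse of \<open>x - 1\<close>, so every term
  becomes a power of \<open>x - 1\<close>.\<close>

lemma hyperbola_monomial:
  assumes "j \<le> m"
  shows "hyperbola m ((var_x - 1) ^ i * (var_y - 1) ^ j) = ([:- 1, 1 :: 'a :: comm_ring_1:] ^ (i + (m - j)))"
proof -
  \<comment> \<open>This is \<open>(x - (x - 1)) ^ j\<close>.\<close>
  have y: "homog j ([:- 1, 1 :: 'a poly:] ^ j) [:0, 1:] [:- 1, 1:] = 1"
  proof (induction j)
    case (Suc j)
    have "homog (1 + j) ([:- 1, 1 :: 'a poly:] * [:- 1, 1:] ^ j) [:0, 1:] [:- 1, 1:]
      = homog 1 [:- 1, 1 :: 'a poly:] [:0, 1:] [:- 1, 1:] * homog j ([:- 1, 1 :: 'a poly:] ^ j) [:0, 1:] [:- 1, 1:]"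
      by (rule homog_mult) (simp_all add: degree_linear_power_le)
    then show ?case using Suc by (simp add: homog_def one_pCons)
  qed (simp add: homog_0)
  have d: "degree ([:- 1, 1 :: 'a poly:] ^ j) \<le> j" by (rule degree_linear_power_le)
  have "hyperbola (j + (m - j)) ((var_x - 1) ^ i * (var_y - 1) ^ j)
      = [:- 1, 1 :: 'a:] ^ i * homog (j + (m - j)) ([:- 1, 1:] ^ j) [:0, 1:] [:- 1, 1:]"
    unfolding hyperbola_def var_x_power var_y_minus_1 by (simp add: homog_smult)
  also have "\<dots> = [:- 1, 1 :: 'a:] ^ (i + (m - j))"
    unfolding homog_raise[OF d] y by (simp add: power_add)
  finally show ?thesis using assms by simp
qed

lemma sum_Pow_power_diff:
  fixes c :: "'a :: comm_ring_1"
  assumes "finite E" shows "(\<Sum>A\<in>Pow E. c ^ (card E - card A)) = (1 + c) ^ card E"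
proof -
  have "(1 + c) ^ card E = (\<Sum>A\<in>Pow E. c ^ card (E - A))"
    using prod_add[OF assms, of "\<lambda>_. 1" "\<lambda>_. c"] by simp
  also have "\<dots> = (\<Sum>A\<in>Pow E. c ^ (card E - card A))"
    by (rule sum.cong[OF refl]) (use assms in \<open>auto simp: card_Diff_subset rev_finite_subset\<close>)
  finally show ?thesis ..
qed

lemma minus_one_power_exponents:
  assumes "s A \<le> s E" "s A \<le> card A"
  shows "(- 1 :: 'a :: comm_ring_1) ^ (s E - s A) * (- 1) ^ (card A - s A) = (- 1) ^ s E * (- 1) ^ card A"
proof -
  have "(- 1 :: 'a) ^ (s E - s A) * (- 1) ^ (card A - s A)
      = (- 1) ^ (s E - s A) * (- 1) ^ (card A - s A) * ((- 1) ^ s A * (- 1) ^ s A)"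
    by (simp flip: power_mult_distrib)
  also have "\<dots> = (- 1) ^ (s E - s A + s A) * (- 1) ^ (card A - s A + s A)"
    by (simp only: power_add mult_ac)
  finally show ?thesis using assms by simp
qed

theorem rank_poly_no_nontrivial_factorization:
  assumes fin: "finite E"
    and s: "\<And>A. A \<subseteq> E \<Longrightarrow> s A \<le> s E \<and> s A \<le> card A \<and> s E + card A \<le> s A + card E"
    and alt: "card E \<ge> 2 \<Longrightarrow> (\<Sum>A\<in>Pow E. (- 1) ^ card A * int (s A)) \<noteq> 0"
  shows "no_nontrivial_factorization (rank_poly E s :: 'a :: {idom, ring_char_0} poly poly)"
proof (rule no_nontrivial_factorization_hyperbola)
  have sE: "s E \<le> card E" using s[of E] by simp
  have le: "card A - s A \<le> card E - s E" if "A \<subseteq> E" for A using s[OF that] by linarith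
  show "hyperbola (card E - s E) (rank_poly E s :: 'a poly poly) = [:0, 1:] ^ card E"
  proof -
    have "hyperbola (card E - s E) (rank_poly E s :: 'a poly poly)
      = (\<Sum>A\<in>Pow E. hyperbola (card E - s E) ((var_x - 1) ^ (s E - s A) * (var_y - 1) ^ (card A - s A)))"
      unfolding rank_poly_def hyperbola_def homog_sum ..
    \<comment> \<open>The exponent of \<open>x - 1\<close> no longer depends on \<open>s\<close>,
      and the sum becomes \<open>(1 + (x - 1)) ^ card E\<close>.\<close>
    also have "\<dots> = (\<Sum>A\<in>Pow E. [:- 1, 1:] ^ (card E - card A))"
    proof (rule sum.cong[OF refl])
      fix A assume "A \<in> Pow E"
      then have A: "A \<subseteq> E" by simp
      have "s E - s A + (card E - s E - (card A - s A)) = card E - card A" using s[OF A] sE by linarith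
      then show "hyperbola (card E - s E) ((var_x - 1) ^ (s E - s A) * (var_y - 1) ^ (card A - s A))
        = [:- 1, 1 :: 'a:] ^ (card E - card A)"
        unfolding hyperbola_monomial[OF le[OF A]] by simp
    qed
    also have "\<dots> = [:0, 1:] ^ card E" unfolding sum_Pow_power_diff[OF fin] by (simp add: one_pCons)
    finally show ?thesis .
  qed
  have deg: "degree ((var_x - 1) ^ i * (var_y - 1) ^ j :: 'a poly poly) \<le> j"
    "degree (coeff ((var_x - 1) ^ i * (var_y - 1) ^ j :: 'a poly poly) t) \<le> i" for i j t
  proof -
    show "degree ((var_x - 1) ^ i * (var_y - 1) ^ j :: 'a poly poly) \<le> j"
      unfolding var_x_power var_y_minus_1
      using degree_mult_le[of "[:[:- 1, 1 :: 'a:] ^ i:]" "[:- 1, 1:] ^ j"]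
        degree_linear_power_le[of j, where ?'a = "'a poly"] by simp
    have "\<exists>c. coeff ([:- 1, 1 :: 'a poly:] ^ j) t = [:c:]" for t
    proof (induction j arbitrary: t)
      case 0
      then show ?case by (cases t) (auto simp: one_pCons)
    next
      case (Suc j)
      obtain c where c: "coeff ([:- 1, 1 :: 'a poly:] ^ j) t = [:c:]" using Suc by blast
      show ?case
      proof (cases t)
        case 0
        then show ?thesis using c by (simp add: coeff_mult_0)
      next
        case (Suc t')
        then show ?thesis using c Suc.IH[of t'] by auto
      qed
    qed
    then obtain c where "coeff ([:- 1, 1 :: 'a poly:] ^ j) t = [:c:]" by blast
    then have "coeff ((var_x - 1) ^ i * (var_y - 1) ^ j :: 'a poly poly) t = smult c ([:- 1, 1:] ^ i)"
      unfolding var_x_power var_y_minus_1 by simp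
    then show "degree (coeff ((var_x - 1) ^ i * (var_y - 1) ^ j :: 'a poly poly) t) \<le> i"
      using degree_smult_le[of c "[:- 1, 1 :: 'a:] ^ i"] degree_linear_power_le[of i, where ?'a = 'a] by simp
  qed
  show "degree (rank_poly E s :: 'a poly poly) \<le> card E - s E"
    unfolding rank_poly_def
  proof (rule degree_sum_le)
    show "finite (Pow E)" using fin by simp
    fix A assume "A \<in> Pow E"
    then show "degree ((var_x - 1) ^ (s E - s A) * (var_y - 1) ^ (card A - s A) :: 'a poly poly) \<le> card E - s E"
      using le[of A] by (intro order_trans[OF deg(1)]) simp
  qed
  have "x_degree (rank_poly E s :: 'a poly poly) \<le> s E"
  proof (rule x_degree_le)
    fix t
    show "degree (coeff (rank_poly E s :: 'a poly poly) t) \<le> s E"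
      unfolding rank_poly_def coeff_sum
    proof (rule degree_sum_le)
      show "finite (Pow E)" using fin by simp
      fix A
      show "degree (coeff ((var_x - 1) ^ (s E - s A) * (var_y - 1) ^ (card A - s A) :: 'a poly poly) t) \<le> s E"
        by (rule order_trans[OF deg(2)]) simp
    qed
  qed
  then show "x_degree (rank_poly E s :: 'a poly poly) + (card E - s E) \<le> card E" using sE by linarith
  assume n: "card E \<ge> 2"
  then have "E \<noteq> {}" by auto
  have "coeff (coeff (rank_poly E s :: 'a poly poly) 0) 1
    = (\<Sum>A\<in>Pow E. - ((- 1) ^ (s E - s A) * (- 1) ^ (card A - s A) * of_nat (s E - s A)))"
    unfolding rank_poly_def coeff_sum
  proof (rule sum.cong[OF refl])
    fix A
    have "coeff ((var_x - 1) ^ (s E - s A) * (var_y - 1) ^ (card A - s A) :: 'a poly poly) 0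
      = [:- 1, 1:] ^ (s E - s A) * (- 1) ^ (card A - s A)"
      unfolding var_x_power var_y_minus_1 by (simp add: coeff_mult_0 coeff_linear_power)
    also have "\<dots> = smult ((- 1) ^ (card A - s A)) ([:- 1, 1:] ^ (s E - s A))"
      by (cases "even (card A - s A)") simp_all
    finally show "coeff (coeff ((var_x - 1) ^ (s E - s A) * (var_y - 1) ^ (card A - s A) :: 'a poly poly) 0) 1
      = - ((- 1) ^ (s E - s A) * (- 1) ^ (card A - s A) * of_nat (s E - s A))"
      by (simp add: coeff_linear_power)
  qed
  also have "\<dots> = (\<Sum>A\<in>Pow E. (- 1) ^ s E * ((- 1) ^ card A * of_nat (s A))
      - (- 1) ^ s E * of_nat (s E) * (- 1) ^ card A)"
  proof (rule sum.cong[OF refl])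
    fix A assume "A \<in> Pow E"
    then have "s A \<le> s E" "s A \<le> card A" using s by auto
    then show "- ((- 1) ^ (s E - s A) * (- 1) ^ (card A - s A) * of_nat (s E - s A) :: 'a)
      = (- 1) ^ s E * ((- 1) ^ card A * of_nat (s A)) - (- 1) ^ s E * of_nat (s E) * (- 1) ^ card A"
      unfolding minus_one_power_exponents[of s A E, OF \<open>s A \<le> s E\<close> \<open>s A \<le> card A\<close>]
      by (simp add: of_nat_diff algebra_simps)
  qed
  also have "\<dots> = (- 1) ^ s E * (\<Sum>A\<in>Pow E. (- 1) ^ card A * of_nat (s A))
      - (- 1) ^ s E * of_nat (s E) * (\<Sum>A\<in>Pow E. (- 1) ^ card A)"
    unfolding sum_subtractf sum_distrib_left ..
  \<comment> \<open>The part coming from \<open>s E\<close> is a multiple of the alternating sum of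
    signs, which is 0. What remains is an integer, and characteristic 0 keeps it nonzero.\<close>
  also have "\<dots> = (- 1) ^ s E * of_int (\<Sum>A\<in>Pow E. (- 1) ^ card A * int (s A))"
    unfolding sum_minus_one_power_card_Pow[OF fin \<open>E \<noteq> {}\<close>] by simp
  finally show "coeff (coeff (rank_poly E s :: 'a poly poly) 0) 1 \<noteq> 0"
    using alt[OF n] by (simp del: of_int_sum)
qed

text \<open>At the origin the terms reduce to signs alternating with \<open>card A\<close>, which
  cancel; a unit has no zero.\<close>

lemma rank_poly_not_unit:
  assumes fin: "finite E" "E \<noteq> {}" and s: "\<And>A. A \<subseteq> E \<Longrightarrow> s A \<le> s E \<and> s A \<le> card A"
  shows "\<not> (rank_poly E s :: 'a :: idom poly poly) dvd 1"
proof
  assume "(rank_poly E s :: 'a poly poly) dvd 1"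
  then obtain q where "1 = (rank_poly E s :: 'a poly poly) * q" by (rule dvdE)
  then have "poly (poly (rank_poly E s * q) 0) 0 = (1 :: 'a)" by (metis poly_1)
  moreover have "poly (poly (rank_poly E s :: 'a poly poly) 0) 0 = 0"
  proof -
    have "poly (poly (rank_poly E s :: 'a poly poly) 0) 0
      = (\<Sum>A\<in>Pow E. (- 1) ^ (s E - s A) * (- 1) ^ (card A - s A))"
      unfolding rank_poly_def var_x_minus_1 var_y_minus_1 by (simp add: poly_sum)
    also have "\<dots> = (\<Sum>A\<in>Pow E. (- 1) ^ s E * (- 1) ^ card A)"
      by (rule sum.cong[OF refl]) (use s minus_one_power_exponents[of s _ E] in auto)
    also have "\<dots> = 0"
      using sum_minus_one_power_card_Pow[OF fin, where ?'a = 'a] by (simp flip: sum_distrib_left)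
    finally show ?thesis .
  qed
  ultimately show False by simp
qed

lemma rank_poly_Un:
  assumes fin: "finite E" "finite F" and disj: "E \<inter> F = {}"
    and s: "\<And>A. A \<subseteq> E \<union> F \<Longrightarrow> s A \<le> card A"
    and mono: "\<And>A. A \<subseteq> E \<Longrightarrow> s A \<le> s E" "\<And>B. B \<subseteq> F \<Longrightarrow> s B \<le> s F"
    and add: "\<And>A B. A \<subseteq> E \<Longrightarrow> B \<subseteq> F \<Longrightarrow> s (A \<union> B) = s A + s B"
  shows "rank_poly (E \<union> F) s = rank_poly E s * rank_poly F s"
proof -
  define g :: "'a set \<Rightarrow> 'b poly poly" where
    "g C = (var_x - 1) ^ (s (E \<union> F) - s C) * (var_y - 1) ^ (card C - s C)" for C
  have g: "g (A \<union> B) = (var_x - 1) ^ (s E - s A) * (var_y - 1) ^ (card A - s A) *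
      ((var_x - 1) ^ (s F - s B) * (var_y - 1) ^ (card B - s B))" if AB: "A \<subseteq> E" "B \<subseteq> F" for A B
  proof -
    have "finite A" "finite B" "A \<inter> B = {}" using AB fin disj finite_subset by blast+
    then have c: "card (A \<union> B) = card A + card B" by (rule card_Un_disjoint)
    have "s A \<le> card A" "s B \<le> card B" using s[of A] s[of B] AB by auto
    then have "s (E \<union> F) - s (A \<union> B) = (s E - s A) + (s F - s B)"
      "card (A \<union> B) - s (A \<union> B) = (card A - s A) + (card B - s B)"
      using add[OF AB] add[of E F] mono(1)[OF AB(1)] mono(2)[OF AB(2)] c by simp_all
    then show ?thesis unfolding g_def by (simp only: power_add mult_ac)
  qed
  have "rank_poly (E \<union> F) s = (\<Sum>C\<in>Pow (E \<union> F). g C)" by (simp add: rank_poly_def g_def)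
  also have "\<dots> = (\<Sum>(A, B)\<in>Pow E \<times> Pow F. g (A \<union> B))"
    by (rule sum.reindex_bij_witness[of _ "\<lambda>(A, B). A \<union> B" "\<lambda>C. (C \<inter> E, C \<inter> F)"])
      (use disj in \<open>auto simp: Int_absorb2 simp flip: Int_Un_distrib\<close>)
  also have "\<dots> = (\<Sum>A\<in>Pow E. \<Sum>B\<in>Pow F. (var_x - 1) ^ (s E - s A) * (var_y - 1) ^ (card A - s A) *
      ((var_x - 1) ^ (s F - s B) * (var_y - 1) ^ (card B - s B)))"
    unfolding sum.cartesian_product[symmetric] by (intro sum.cong refl g) auto
  also have "\<dots> = rank_poly E s * rank_poly F s" unfolding rank_poly_def sum_product ..
  finally show ?thesis .
qed

context dart_pairing begin

theorem rank_poly_no_nontrivial_factorization_iff: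
  assumes p: "p permutes D" and "D \<noteq> {}"
  shows "no_nontrivial_factorization (rank_poly E (dart_rank p) :: 'a :: {idom, ring_char_0} poly poly)
    \<longleftrightarrow> (\<nexists>I. separated p I)"
proof
  have le_card: "dart_rank p A \<le> card A" if "A \<subseteq> E" for A
    using dart_rank_mono[OF p, of "{}" A] dart_rank_empty[OF p] that by simp
  note mono = dart_rank_mono[OF p]
  {
    assume irr: "no_nontrivial_factorization (rank_poly E (dart_rank p) :: 'a poly poly)"
    show "\<nexists>I. separated p I"
    proof
      assume "\<exists>I. separated p I"
      then obtain I where I: "separated p I" by blast
      \<comment> \<open>The edges inside \<open>I\<close> and the remaining edges give the two
        factors. Neither set is empty, as \<open>I\<close> is a nonempty proper union of
        edges.\<close>
      define F where "F = {e \<in> E. e \<subseteq> I}"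
      have F: "F \<subseteq> E" "E - F \<subseteq> E" "F \<union> (E - F) = E" by (auto simp: F_def)
      have "rank_poly (F \<union> (E - F)) (dart_rank p)
          = rank_poly F (dart_rank p) * (rank_poly (E - F) (dart_rank p) :: 'a poly poly)"
      proof (rule rank_poly_Un)
        show "finite F" "finite (E - F)" using F finite_E finite_subset by auto
        show "F \<inter> (E - F) = {}" by blast
        show "dart_rank p A \<le> card A" if "A \<subseteq> F \<union> (E - F)" for A using le_card that F by simp
        show "dart_rank p A \<le> dart_rank p F" if "A \<subseteq> F" for A using mono[OF that F(1)] by simp
        show "dart_rank p A \<le> dart_rank p (E - F)" if "A \<subseteq> E - F" for A using mono[OF that F(2)] by simp
        show "dart_rank p (A \<union> B) = dart_rank p A + dart_rank p B" if "A \<subseteq> F" "B \<subseteq> E - F" for A B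
          using dart_rank_separated[OF p I] that by (simp add: F_def)
      qed
      then have *: "rank_poly E (dart_rank p)
          = rank_poly F (dart_rank p) * (rank_poly (E - F) (dart_rank p) :: 'a poly poly)"
        using F(3) by simp
      have nu: "\<not> (rank_poly C (dart_rank p) :: 'a poly poly) dvd 1" if C: "C \<subseteq> E" "C \<noteq> {}" for C
      proof (rule rank_poly_not_unit)
        show "finite C" using C(1) finite_E finite_subset by blast
        show "C \<noteq> {}" by (rule C(2))
        fix A assume "A \<subseteq> C"
        then show "dart_rank p A \<le> dart_rank p C \<and> dart_rank p A \<le> card A"
          using mono[of A C] C(1) le_card[of A] by auto
      qed
      obtain x where "x \<in> I" "opp x \<in> I" "x \<in> D" using I by (auto simp: separated_def)
      then have "F \<noteq> {}" by (auto simp: F_def E_def)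
      moreover obtain y where "y \<in> D" "y \<notin> I" using I by (auto simp: separated_def)
      then have "E - F \<noteq> {}" by (auto simp: F_def E_def)
      ultimately show False
        using irr * nu[OF F(1)] nu[OF F(2)] unfolding no_nontrivial_factorization_def by blast
    qed
  }
  assume no: "\<nexists>I. separated p I"
  show "no_nontrivial_factorization (rank_poly E (dart_rank p) :: 'a poly poly)"
  proof (rule rank_poly_no_nontrivial_factorization[OF finite_E])
    show "dart_rank p A \<le> dart_rank p E \<and> dart_rank p A \<le> card A \<and>
        dart_rank p E + card A \<le> dart_rank p A + card E" if "A \<subseteq> E" for A
      using le_card[OF that] mono[OF that order_refl] by simp
    assume "card E \<ge> 2"
    moreover have "orbit_sum p E \<noteq> 0"
    proof
      assume "orbit_sum p E = 0"
      moreover have "U = D" if "U \<subseteq> D" "U \<noteq> {}" "\<And>x. x \<in> U \<Longrightarrow> p x \<in> U \<and> opp x \<in> U" for U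
      proof (rule ccontr)
        assume "U \<noteq> D"
        then have "separated p U" using that by (simp add: separated_def)
        then show False using no by blast
      qed
      ultimately show False using connected_orbit_sum_0_imp_separated[OF p assms(2)] no by blast
    qed
    ultimately show "(\<Sum>A\<in>Pow E. (- 1) ^ card A * int (dart_rank p A)) \<noteq> 0"
      using sum_dart_rank[OF p] by auto
  qed
qed

end

section \<open>Ribbon graphs and joins\<close>

locale rotation_system =
  fixes G :: "('v, 'd) ribbon_graph"
  assumes orientable: "orientable_ribbon_graph G"

sublocale rotation_system \<subseteq> dart_pairing "darts G" "opp G"
  using orientable by unfold_locales (auto simp: orientable_ribbon_graph_def)

context rotation_system begin

lemma rot_permutes: "rot G permutes darts G"
  using orientable by (simp add: orientable_ribbon_graph_def)

lemma orbit_rot: "d \<in> darts G \<Longrightarrow> orbit (rot G) d = {e \<in> darts G. vert G e = vert G d}"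
  using orientable by (simp add: orientable_ribbon_graph_def)

lemma vert_in: "d \<in> darts G \<Longrightarrow> vert G d \<in> verts G"
  using orientable by (simp add: orientable_ribbon_graph_def)

lemma rot_in: "d \<in> darts G \<Longrightarrow> rot G d \<in> darts G"
  using permutes_in_image[OF rot_permutes] by simp

lemma vert_rot: "d \<in> darts G \<Longrightarrow> vert G (rot G d) = vert G d"
  using orbit.base[of "rot G" d] orbit_rot[of d] by simp

lemma edges_eq: "edges G = E"
  by (simp add: edges_def E_def)

lemma boundary_step_eq: "boundary_step G A = rot G \<circ> flip A"
  by (simp add: boundary_step_def flip_def fun_eq_iff)

lemma card_verts: "card (verts G) = num_orbits (darts G) (rot G) + card (isolated_verts G)"
proof -
  let ?V = "vert G ` darts G"
  have "orbit (rot G) ` darts G = (\<lambda>v. {e \<in> darts G. vert G e = v}) ` ?V"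
    unfolding image_image by (rule image_cong) (simp_all add: orbit_rot)
  moreover have "inj_on (\<lambda>v. {e \<in> darts G. vert G e = v}) ?V"
    by (rule inj_onI) blast
  ultimately have "num_orbits (darts G) (rot G) = card ?V"
    by (simp add: num_orbits_def card_image)
  moreover have "verts G = ?V \<union> isolated_verts G" "?V \<inter> isolated_verts G = {}"
    using vert_in by (auto simp: isolated_verts_def)
  moreover have "finite (verts G)" using orientable by (simp add: orientable_ribbon_graph_def)
  ultimately show ?thesis using card_Un_disjoint[of ?V "isolated_verts G"] by (metis finite_Un)
qed

text \<open>The components cancel between \<open>rk\<close> and half the Euler genus, and isolated
  vertices cancel between vertices and boundary components. Writing the Euler genus as twice an
  integer makes the halving exact.\<close>

lemma sigma_eq:
  assumes "A \<subseteq> E" shows "sigma G A = int (dart_rank (rot G) A)"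
proof -
  have nb: "num_boundary G A = num_orbits (darts G) (rot G \<circ> flip A) + card (isolated_verts G)"
    by (simp add: num_boundary_def boundary_step_eq num_orbits_def)
  have "euler_genus G A = 2 * (int (num_components G A) - int (card (verts G)) + int (dart_rank (rot G) A))"
    using dart_rank_twice[OF rot_permutes assms] by (simp add: euler_genus_def nb card_verts)
  then show ?thesis by (simp add: sigma_def rk_def)
qed

lemma ribbon_poly_eq: "ribbon_poly G = rank_poly E (dart_rank (rot G))"
  unfolding ribbon_poly_def rank_poly_def edges_eq
proof (rule sum.cong[OF refl])
  fix A assume "A \<in> Pow E"
  then have A: "A \<subseteq> E" by simp
  show "(var_x - 1) ^ nat (sigma G E - sigma G A) * (var_y - 1) ^ nat (int (card A) - sigma G A)
    = (var_x - 1) ^ (dart_rank (rot G) E - dart_rank (rot G) A) * (var_y - 1) ^ (card A - dart_rank (rot G) A)"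
    unfolding sigma_eq[OF A] sigma_eq[OF order_refl] by (simp flip: of_nat_diff add: nat_diff_distrib')
qed

text \<open>A closed set contains all darts at each vertex it touches and their opposites, so it
  spreads along every path.\<close>

lemma connected_closed_eq_darts:
  assumes "connected_graph G" and U: "U \<subseteq> darts G" "U \<noteq> {}"
    and cl: "\<And>x. x \<in> U \<Longrightarrow> rot G x \<in> U \<and> opp G x \<in> U"
  shows "U = darts G"
proof -
  have same_vert: "e \<in> U" if "u \<in> U" "e \<in> darts G" "vert G e = vert G u" for e u
  proof -
    have "orbit (rot G) u \<subseteq> U" by (rule orbit_invariant_subset[OF that(1)]) (use cl in blast)
    moreover have "e \<in> orbit (rot G) u" using that U(1) orbit_rot[of u] by auto
    ultimately show ?thesis by blast
  qed
  obtain d where d: "d \<in> U" using U by blast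
  have "d' \<in> U" if d': "d' \<in> darts G" for d'
  proof -
    have "(vert G d, vert G d') \<in> (adjacency G (edges G))\<^sup>*"
      using assms(1) d d' U(1) vert_in unfolding connected_graph_def same_component_def by blast
    then have "vert G d' \<in> vert G ` U"
    proof (induction rule: rtrancl_induct)
      case base
      then show ?case using d by simp
    next
      case (step v w)
      obtain e where e: "v = vert G e" "w = vert G (opp G e)" "e \<in> darts G"
        using step.hyps(2) Union_E by (auto simp: adjacency_def edges_eq)
      then have "e \<in> U" using step.IH same_vert by (metis imageE)
      then show ?case using cl[of e] e(2) by blast
    qed
    then show ?thesis using same_vert d' by (metis imageE)
  qed
  then show ?thesis using U(1) by blast
qed

lemma not_connected_imp_separated:
  assumes "\<not> connected_graph G" "isolated_verts G = {}"
  shows "\<exists>I. separated (rot G) I"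
proof -
  let ?R = "(adjacency G (edges G))\<^sup>*"
  obtain u v where uv: "u \<in> verts G" "v \<in> verts G" "(u, v) \<notin> ?R"
    using assms(1) unfolding connected_graph_def same_component_def by blast
  obtain d where d: "d \<in> darts G" "u = vert G d" using uv(1) assms(2) by (auto simp: isolated_verts_def)
  obtain d' where d': "d' \<in> darts G" "v = vert G d'" using uv(2) assms(2) by (auto simp: isolated_verts_def)
  \<comment> \<open>The darts on the component of \<open>u\<close>; rotation stays at a vertex, so
    there is no exit.\<close>
  define I where "I = {e \<in> darts G. (u, vert G e) \<in> ?R}"
  have "separated (rot G) I"
    unfolding separated_def
  proof (intro conjI ballI impI)
    show "I \<subseteq> darts G" by (auto simp: I_def)
    have "d \<in> I" using d by (simp add: I_def)
    then show "I \<noteq> {}" by blast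
    have "d' \<notin> I" using d' uv(3) by (simp add: I_def)
    then show "I \<noteq> darts G" using d' by blast
    fix x assume x: "x \<in> I"
    then have xD: "x \<in> darts G" by (simp add: I_def)
    have "(vert G x, vert G (opp G x)) \<in> adjacency G (edges G)"
      using xD Union_E by (auto simp: adjacency_def edges_eq)
    then show "opp G x \<in> I" using x opp_in[OF xD] by (auto simp: I_def intro: rtrancl_into_rtrancl)
    fix y assume "rot G x \<notin> I"
    moreover have "rot G x \<in> I" using x xD rot_in[OF xD] vert_rot[OF xD] by (simp add: I_def)
    ultimately show "x = y" by blast
  qed
  then show ?thesis by blast
qed

end

section \<open>Joins and separating sets with one exit\<close>

lemma is_join_imp_separated:
  assumes "orientable_ribbon_graph G" "is_join_of_smaller G"
  shows "\<exists>I. dart_pairing.separated (darts G) (opp G) (rot G) I"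
proof -
  interpret rotation_system G by unfold_locales (rule assms(1))
  obtain G1 d1 G2 d2 where o: "orientable_ribbon_graph G1" "orientable_ribbon_graph G2"
    and j: "joinable G1 d1 G2 d2" and G: "G = join G1 d1 G2 d2"
    using assms(2) unfolding is_join_of_smaller_def by blast
  have perm: "rot G1 permutes darts G1" "rot G2 permutes darts G2"
    "opp G1 permutes darts G1" "opp G2 permutes darts G2"
    using o by (simp_all add: orientable_ribbon_graph_def)
  have dj: "d1 \<in> darts G1" "d2 \<in> darts G2" "darts G1 \<inter> darts G2 = {}"
    using j by (simp_all add: joinable_def)
  have D: "darts G = darts G1 \<union> darts G2" by (simp add: G join_def)
  have "separated (rot G) (darts G1)"
    unfolding separated_def
  proof (intro conjI ballI impI)
    show "darts G1 \<subseteq> darts G" "darts G1 \<noteq> {}" "darts G1 \<noteq> darts G" using D dj by auto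
    fix x assume x: "x \<in> darts G1"
    have "x \<notin> darts G2" using x dj(3) by blast
    then show "opp G x \<in> darts G1"
      using x permutes_in_image[OF perm(3)] permutes_not_in[OF perm(4)] by (simp add: G join_def)
    \<comment> \<open>On the darts of \<open>G1\<close> the joined rotation is that of
      \<open>G1\<close>, except at \<open>d1\<close>, where it is redirected into
      \<open>G2\<close>.\<close>
    have exit: "y = d1" if y: "y \<in> darts G1" "rot G y \<notin> darts G1" for y
    proof (rule ccontr)
      assume "y \<noteq> d1"
      moreover have "y \<notin> darts G2" "y \<noteq> d2" using y dj by auto
      ultimately have "rot G y = rot G1 y"
        using permutes_not_in[OF perm(2)] by (simp add: G join_def)
      then show False using y permutes_in_image[OF perm(1)] by simp
    qed
    fix y assume y: "y \<in> darts G1" and out: "rot G x \<notin> darts G1" "rot G y \<notin> darts G1"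
    show "x = y" using exit[OF x out(1)] exit[OF y out(2)] by simp
  qed
  then show ?thesis by blast
qed

text \<open>With \<open>a\<close> the exit of \<open>I\<close> and \<open>rot G b\<close> its entry,
  the rotation is the first-return map to \<open>I\<close>. Outside \<open>I\<close> both
  \<open>rot\<close> and \<open>opp\<close> are the identity, as the compositions in
  \<open>join\<close> require, while \<open>vert\<close> keeps its values so that the join recovers
  it.\<close>

definition part :: "('v, 'd) ribbon_graph \<Rightarrow> 'd set \<Rightarrow> 'd \<Rightarrow> 'd \<Rightarrow> ('v, 'd) ribbon_graph" where
  "part G I a b =
     \<lparr> verts = vert G ` I, darts = I, vert = vert G,
       rot = (\<lambda>d. if d = a then rot G b else if d \<in> I then rot G d else d),
       opp = perm_restrict (opp G) I \<rparr>"

context rotation_system begin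

text \<open>The cycles of the first-return map are the traces on \<open>I\<close> of the old cycles,
  that is, the darts of \<open>I\<close> at one vertex.\<close>

lemma orientable_part:
  assumes I: "I \<subseteq> darts G" and opp: "\<And>x. x \<in> I \<Longrightarrow> opp G x \<in> I"
    and a: "a \<in> I" "rot G a \<notin> I" and ex: "\<And>x. x \<in> I \<Longrightarrow> x \<noteq> a \<Longrightarrow> rot G x \<in> I"
    and b: "b \<notin> I" "rot G b \<in> I" and en: "\<And>y. y \<notin> I \<Longrightarrow> rot G y \<in> I \<Longrightarrow> y = b"
  shows "orientable_ribbon_graph (part G I a b)"
  unfolding orientable_ribbon_graph_def
proof (intro conjI ballI)
  define r where "r = (\<lambda>d. if d = a then rot G b else if d \<in> I then rot G d else d)"
  have sel: "verts (part G I a b) = vert G ` I" "darts (part G I a b) = I" "vert (part G I a b) = vert G"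
    "rot (part G I a b) = r" "opp (part G I a b) = perm_restrict (opp G) I"
    by (simp_all add: part_def r_def)
  have finI: "finite I" using I fin finite_subset by blast
  show "finite (verts (part G I a b))" "finite (darts (part G I a b))" using finI by (simp_all add: sel)
  note rot_eq = inj_eq[OF permutes_inj[OF rot_permutes]]
  have rI: "r x \<in> I" if "x \<in> I" for x using that ex b by (simp add: r_def)
  have "inj_on r I"
  proof (rule inj_onI)
    fix x y assume "x \<in> I" "y \<in> I" "r x = r y"
    then show "x = y" using b(1) by (auto simp: r_def rot_eq split: if_splits)
  qed
  then have "bij_betw r I I"
    using endo_inj_surj[OF finI, of r] rI by (auto simp: bij_betw_def)
  then show "rot (part G I a b) permutes darts (part G I a b)"
    unfolding sel by (rule bij_imp_permutes) (use a in \<open>auto simp: r_def\<close>)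
  have opp_twice: "perm_restrict (opp G) I (perm_restrict (opp G) I d) = d" for d
    using opp[of d] opp_opp[of d] I by (cases "d \<in> I") (auto simp: perm_restrict_def)
  show "opp (part G I a b) permutes darts (part G I a b)"
    unfolding sel permutes_def
  proof (intro conjI allI impI)
    show "perm_restrict (opp G) I x = x" if "x \<notin> I" for x using that by (simp add: perm_restrict_def)
    show "\<exists>!x. perm_restrict (opp G) I x = y" for y using opp_twice by metis
  qed
  fix d assume "d \<in> darts (part G I a b)"
  then have d: "d \<in> I" "d \<in> darts G" using I by (auto simp: sel)
  show "vert (part G I a b) d \<in> verts (part G I a b)" using d by (simp add: sel)
  show "opp (part G I a b) d \<noteq> d" using d opp_neq by (simp add: sel perm_restrict_def)
  show "opp (part G I a b) (opp (part G I a b) d) = d" by (simp add: sel opp_twice)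
  have "orbit r d = orbit (rot G) d \<inter> I"
    by (rule orbit_first_return[OF rot_permutes fin I a ex b en]) (use d a in \<open>auto simp: r_def\<close>)
  then show "orbit (rot (part G I a b)) d
      = {e \<in> darts (part G I a b). vert (part G I a b) e = vert (part G I a b) d}"
    using orbit_rot[OF d(2)] I by (auto simp: sel)
qed

lemma card_edges_part:
  assumes I: "I \<subseteq> darts G" "I \<noteq> darts G" and opp: "\<And>x. x \<in> I \<Longrightarrow> opp G x \<in> I"
  shows "card (edges (part G I a b)) < card (edges G)"
proof -
  have "finite (edges G)" unfolding edges_eq by (rule finite_E)
  moreover have "edges (part G I a b) \<subset> edges G"
  proof
    have eq: "edges (part G I a b) = {{d, opp G d} |d. d \<in> I}"
      unfolding edges_def part_def by (auto simp: perm_restrict_def)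
    then show "edges (part G I a b) \<subseteq> edges G" using I(1) by (auto simp: edges_def)
    obtain d where "d \<in> darts G" "d \<notin> I" using I by blast
    have "e \<subseteq> I" if "e \<in> edges (part G I a b)" for e using that opp by (auto simp: eq)
    then have "{d, opp G d} \<notin> edges (part G I a b)" using \<open>d \<notin> I\<close> by blast
    moreover have "{d, opp G d} \<in> edges G" using \<open>d \<in> darts G\<close> by (auto simp: edges_def)
    ultimately show "edges (part G I a b) \<noteq> edges G" by blast
  qed
  ultimately show ?thesis by (rule psubset_card_mono)
qed

text \<open>Connectedness forces an exit \<open>a\<close>, hence a unique entry from some
  \<open>b\<close>. The complement is then left at \<open>b\<close> and entered from
  \<open>a\<close>. Both sides become parts meeting only in the vertex of \<open>a\<close>, and the
  redirection at \<open>a\<close> and \<open>b\<close> in \<open>join\<close> restores the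
  rotation.\<close>

lemma separated_imp_is_join:
  assumes conn: "connected_graph G" and iso: "isolated_verts G = {}" and sep: "separated (rot G) I"
  shows "is_join_of_smaller G"
proof -
  have I: "I \<subseteq> darts G" "I \<noteq> {}" "I \<noteq> darts G" "\<And>x. x \<in> I \<Longrightarrow> opp G x \<in> I"
    and one: "\<And>x y. x \<in> I \<Longrightarrow> y \<in> I \<Longrightarrow> rot G x \<notin> I \<Longrightarrow> rot G y \<notin> I \<Longrightarrow> x = y"
    using sep unfolding separated_def by blast+
  obtain a where a: "a \<in> I" "rot G a \<notin> I"
    using connected_closed_eq_darts[OF conn I(1,2)] I(3,4) by blast
  have ex: "rot G x \<in> I" if "x \<in> I" "x \<noteq> a" for x using one[OF that(1) a(1)] a(2) that(2) by blast
  have "finite I" using I(1) fin finite_subset by blast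
  then obtain z where z: "I - rot G ` (I - {a}) = {z}"
    using unique_entry[OF rot_permutes _ a ex] by blast
  define b where "b = inv (rot G) z"
  note entry = unique_entry_point[OF rot_permutes a(2) z, folded b_def]
  have b: "b \<notin> I" "rot G b \<in> I" using entry z by auto
  have en: "y = b" if "y \<notin> I" "rot G y \<in> I" for y by (rule entry(3)[OF that])
  have bD: "b \<in> darts G"
  proof (rule ccontr)
    assume "b \<notin> darts G"
    then have "rot G b = b" by (rule permutes_not_in[OF rot_permutes])
    then show False using b by simp
  qed
  define J where "J = darts G - I"
  have aD: "a \<in> darts G" using a I(1) by blast
  have J: "J \<subseteq> darts G" "J \<noteq> darts G" using I(1,2) by (auto simp: J_def)
  have oppJ: "opp G x \<in> J" if "x \<in> J" for x
  proof -
    have x: "x \<in> darts G" "x \<notin> I" using that by (auto simp: J_def)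
    have "opp G x \<notin> I" using I(4)[of "opp G x"] opp_opp[OF x(1)] x(2) by auto
    then show ?thesis using opp_in[OF x(1)] by (simp add: J_def)
  qed
  have bJ: "b \<in> J" "rot G b \<notin> J" using b bD by (auto simp: J_def)
  have aJ: "a \<notin> J" "rot G a \<in> J" using a rot_in[OF aD] by (auto simp: J_def)
  have exJ: "rot G x \<in> J" if "x \<in> J" "x \<noteq> b" for x
    using that en[of x] rot_in[of x] by (auto simp: J_def)
  have enJ: "y = a" if "y \<notin> J" "rot G y \<in> J" for y
  proof -
    have "y \<in> darts G" using that(2) permutes_in_image[OF rot_permutes] by (simp add: J_def)
    then show ?thesis using that ex[of y] by (auto simp: J_def)
  qed
  \<comment> \<open>At any other vertex the cycle cannot leave \<open>I\<close>, as the only exit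
    sits at the vertex of \<open>a\<close>.\<close>
  have meet: "v = vert G a" if v: "v \<in> vert G ` I" "v \<in> vert G ` J" for v
  proof (rule ccontr)
    assume va: "v \<noteq> vert G a"
    obtain d e where d: "d \<in> I" "v = vert G d" and e: "e \<in> J" "v = vert G e" using v by blast
    have "orbit (rot G) d \<subseteq> {x \<in> I. vert G x = v}"
    proof (rule orbit_invariant_subset)
      show "d \<in> {x \<in> I. vert G x = v}" using d by simp
      fix y assume y: "y \<in> {x \<in> I. vert G x = v}"
      then have "y \<in> darts G" "y \<noteq> a" using I(1) va by auto
      then show "rot G y \<in> {x \<in> I. vert G x = v}" using y ex[of y] vert_rot[of y] by simp
    qed
    moreover have "e \<in> orbit (rot G) d" using orbit_rot[of d] d e I(1) by (auto simp: J_def)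
    ultimately show False using e(1) by (auto simp: J_def)
  qed
  have ab: "vert G b = vert G a"
  proof (rule meet)
    show "vert G b \<in> vert G ` I" using vert_rot[OF bD] b(2) by (metis imageI)
    show "vert G b \<in> vert G ` J" using bJ by blast
  qed
  have "vert G a \<in> vert G ` I" "vert G a \<in> vert G ` J" using a bJ ab by (auto intro: rev_image_eqI)
  then have "vert G ` I \<inter> vert G ` J = {vert G a}" using meet by blast
  then have "joinable (part G I a b) a (part G J b a) b"
    using a bJ ab by (auto simp: joinable_def part_def J_def)
  moreover have "G = join (part G I a b) a (part G J b a) b"
  proof (rule ribbon_graph.equality)
    have "verts G = vert G ` darts G" using iso vert_in by (auto simp: isolated_verts_def)
    then show "verts G = verts (join (part G I a b) a (part G J b a) b)"
      using I(1) by (auto simp: join_def part_def J_def)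
    show "darts G = darts (join (part G I a b) a (part G J b a) b)"
      using I(1) by (auto simp: join_def part_def J_def)
    show "vert G = vert (join (part G I a b) a (part G J b a) b)"
      by (simp add: join_def part_def fun_eq_iff)
    show "rot G = rot (join (part G I a b) a (part G J b a) b)"
    proof
      fix x
      consider "x = a" | "x = b" | "x \<in> I" "x \<noteq> a" "x \<noteq> b" | "x \<in> J" "x \<noteq> a" "x \<noteq> b" | "x \<notin> darts G"
        by (auto simp: J_def)
      then show "rot G x = rot (join (part G I a b) a (part G J b a) b) x"
      proof cases
        case 3
        then show ?thesis using ex by (simp add: join_def part_def J_def)
      next
        case 4
        then have "rot G x \<in> J" using exJ by simp
        moreover have "rot G x \<noteq> a" using aJ calculation by blast
        ultimately show ?thesis using 4 by (auto simp: join_def part_def J_def)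
      next
        case 5
        then have "rot G x = x" by (rule permutes_not_in[OF rot_permutes])
        moreover have "x \<noteq> a" "x \<noteq> b" "x \<notin> I" "x \<notin> J" using 5 aD bD I(1) J(1) by blast+
        ultimately show ?thesis by (simp add: join_def part_def)
      qed (use a b bJ aJ in \<open>auto simp: join_def part_def\<close>)
    qed
    show "opp G = opp (join (part G I a b) a (part G J b a) b)"
    proof
      fix x
      consider "x \<in> I" "x \<notin> J" | "x \<in> J" "x \<notin> I" | "x \<notin> darts G" by (auto simp: J_def)
      then show "opp G x = opp (join (part G I a b) a (part G J b a) b) x"
      proof cases
        case 2
        then show ?thesis using oppJ[of x] by (simp add: join_def part_def perm_restrict_def J_def)
      next
        case 3
        then show ?thesis
          using permutes_not_in[OF opp_permutes] I(1) J(1) by (auto simp: join_def part_def perm_restrict_def)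
      qed (simp add: join_def part_def perm_restrict_def)
    qed
  qed simp
  moreover have "orientable_ribbon_graph (part G I a b)"
    by (rule orientable_part[OF I(1,4) a ex b en])
  moreover have "orientable_ribbon_graph (part G J b a)"
    by (rule orientable_part[OF J(1) oppJ bJ exJ aJ enJ])
  moreover have "card (edges (part G I a b)) < card (edges G)" by (rule card_edges_part[OF I(1,3,4)])
  moreover have "card (edges (part G J b a)) < card (edges G)" by (rule card_edges_part[OF J oppJ])
  ultimately show ?thesis unfolding is_join_of_smaller_def by blast
qed

end

text \<open>An isolated vertex does not change the polynomial; \<open>iso\<close> admits one only
  when it is the only vertex. The argument works over any domain of characteristic 0, which covers
  both rings.\<close>

lemma no_nontrivial_factorization_ribbon_poly:
  fixes G :: "('v, 'd) ribbon_graph"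
  assumes G: "orientable_ribbon_graph G"
    and iso: "isolated_verts G = {} \<or> card (verts G) = 1"
  shows "no_nontrivial_factorization (ribbon_poly G :: 'a :: {idom, ring_char_0} poly poly) \<longleftrightarrow>
    connected_graph G \<and> \<not> is_join_of_smaller G"
proof -
  interpret rotation_system G by unfold_locales (rule G)
  show ?thesis
  proof (cases "darts G = {}")
    case True
    \<comment> \<open>Without darts the polynomial is 1, which counts as irreducible, and
      \<open>iso\<close> leaves at most one vertex.\<close>
    have "edges G = {}" using True by (simp add: edges_def)
    then have "(ribbon_poly G :: 'a poly poly) = 1" by (simp add: ribbon_poly_def sigma_eq)
    then have "no_nontrivial_factorization (ribbon_poly G :: 'a poly poly)"
      by (auto simp: no_nontrivial_factorization_def intro: dvdI)
    moreover have "\<not> is_join_of_smaller G"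
      using \<open>edges G = {}\<close> by (auto simp: is_join_of_smaller_def)
    moreover have "u = v" if "u \<in> verts G" "v \<in> verts G" for u v
      using iso
    proof
      assume "isolated_verts G = {}"
      then show ?thesis using that True by (simp add: isolated_verts_def)
    next
      assume "card (verts G) = 1"
      then show ?thesis using that by (metis card_1_singletonE singletonD)
    qed
    then have "connected_graph G"
      unfolding connected_graph_def same_component_def by (auto intro: rtrancl_eq_or_trancl[THEN iffD2])
    ultimately show ?thesis by simp
  next
    case False
    have iso0: "isolated_verts G = {}"
      using iso
    proof
      assume "card (verts G) = 1"
      then obtain v where "verts G = {v}" by (rule card_1_singletonE)
      then show ?thesis using False vert_in by (auto simp: isolated_verts_def)
    qed
    have "(\<nexists>I. separated (rot G) I) \<longleftrightarrow> connected_graph G \<and> \<not> is_join_of_smaller G"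
      using not_connected_imp_separated[OF _ iso0] is_join_imp_separated[OF G]
        separated_imp_is_join[OF _ iso0] by blast
    then show ?thesis
      using rank_poly_no_nontrivial_factorization_iff[OF rot_permutes False, where ?'a = 'a]
      by (simp add: ribbon_poly_eq)
  qed
qed

theorem theorem1p1:
  fixes G :: "('v, 'd) ribbon_graph"
  assumes "orientable_ribbon_graph G"
    and "isolated_verts G = {} \<or> card (verts G) = 1"
  shows "(no_nontrivial_factorization (ribbon_poly G :: int poly poly) \<longleftrightarrow>
            connected_graph G \<and> \<not> is_join_of_smaller G) \<and>
         (no_nontrivial_factorization (ribbon_poly G :: complex poly poly) \<longleftrightarrow>
            connected_graph G \<and> \<not> is_join_of_smaller G)"
  using no_nontrivial_factorization_ribbon_poly[OF assms, where ?'a = int]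
    no_nontrivial_factorization_ribbon_poly[OF assms, where ?'a = complex] by simp

end
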